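(* For every $\chi\in\mathfrak a^*$ and every $f\in C_c(W)$, $$\lim_{T\to\infty}\frac{1}{T^{a_\chi}(\log T)^{b_\chi-1}}\int_{\mathfrak a^+}f(\phi(a)/T)\,e^{\chi(a)}\,da=\kappa_\chi\,L_\chi(f)<\infty,$$ where $\kappa_\chi=\mathrm{Vol}\big(\mathfrak a^+\cap\ker I_\chi\cap\{\lambda_1=1\}\big)$.
   Context: Setting. - $\mathfrak a\cong\mathbb R^r$ is a real vector space and $W$ a finite-dimensional real vector space. - $w_1,\dots,w_k\in W$ are linearly independent, $\lambda_1,\dots,\lambda_k\in\mathfrak a^*$, and $\phi:\mathfrak a\to W$, $\phi(a)=\sum_{i=1}^k e^{\lambda_i(a)}w_i$. - $\Delta$ is a fixed basis of $\mathfrak a^*$, and $\mathfrak a^+=\{a:\alpha(a)\ge0\ \forall\alpha\in\Delta\}$. - Assume (1) $\lambda_1=\sum_{\alpha\in\Delta}m_\alpha\alpha$ with all $m_\alpha>0$, and (2) for every $i$, $\lambda_1-\lambda_i=\sum_{\alpha\in\Delta}m_{i,\alpha}\alpha$ with $m_{i,\alpha}\ge0$. Put $\operatorname{supp}\lambda_i=\{\alpha:m_{i,\alpha}>0\}$. Definitions attached to $\chi=\sum_{\alpha\in\Delta}v_\alpha(\chi)\alpha$. - $a_\chi=\max_{\alpha\in\Delta}v_\alpha(\chi)/m_\alpha$, $I_\chi=\{\alpha\in\Delta:v_\alpha(\chi)/m_\alpha<a_\chi\}$, and $b_\chi=\#(\Delta\setminus I_\chi)$. - $\ker I_\chi=\bigcap_{\alpha\in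 I_\chi}\ker\alpha$, and $\mathfrak d_0=\ker\chi\cap\ker I_\chi$ (which equals $\ker\lambda_i\cap\ker I_\chi$ whenever $\operatorname{supp}\lambda_i\subset I_\chi$). - $\mathfrak d^+=\{\bar a\in\mathfrak a/\mathfrak d_0:\alpha(a)\ge0\ \forall\alpha\in I_\chi\}$. - $\psi(\bar a)=\sum_{i:\operatorname{supp}\lambda_i\subset I_\chi}e^{\lambda_i(a)}w_i$ for $\bar a\in\mathfrak a/\mathfrak d_0$ (well defined). - $L_\chi(f)=\int_{\mathfrak d^+}f(\psi(\bar a))e^{\chi(a)}\,d\bar a$ (with $e^{\chi(a)}$ well defined on $\mathfrak a/\mathfrak d_0$). Measures: $da$ and $d\bar a$ are Lebesgue measures on $\mathfrak a$ and $\mathfrak a/\mathfrak d_0$, and $\mathrm{Vol}$ is the induced Lebesgue measure on the level set, all normalized compatibly.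
   Formalization: The formal theorem assumes a_χ > 0. If a_χ = 0, ψ is not well defined on 𝔞/𝔡₀ (e.g. χ = 0); if a_χ < 0, L_χ(f) = ∞ for every f ≥ 0 with f(0) > 0 (e.g. r = k = 1, λ₁ = α, χ = −α), so the claim for every f fails for each excluded χ. *)

theory Defs
  imports "HOL-Analysis.Analysis" "HOL-Probability.Probability"
begin

text \<open>Conventions. The space a is a Euclidean space 'a; a linear functional on a is
  represented by a vector l via a |-> l \<bullet> a. The basis Delta of a^* is a set of such vectors.
  Coefficients of chi in the basis Delta are given by the library's representation.
  All Lebesgue measures are the ones induced by the inner product of 'a (this is a
  compatible normalisation: lborel on 'a is the product of the induced measures on a
  subspace and its orthogonal complement).  The quotient a/d0 is identified with the
  orthogonal complement of d0.\<close>

definition subspace_measure :: "'a::euclidean_space set \<Rightarrow> 'a measure" where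
  "subspace_measure S =
    (let d = dim S;
         e = (SOME e :: nat \<Rightarrow> 'a. (\<forall>i<d. e i \<in> S) \<and>
                 (\<forall>i<d. \<forall>j<d. e i \<bullet> e j = (if i = j then 1 else 0)))
     in distr (PiM {..<d} (\<lambda>_. lborel)) borel (\<lambda>x. \<Sum>i<d. x i *\<^sub>R e i))"

definition affine_measure :: "'a::euclidean_space set \<Rightarrow> 'a measure" where
  "affine_measure A =
    (let p = (SOME p. p \<in> A)
     in distr (subspace_measure ((\<lambda>x. x - p) ` A)) borel (\<lambda>y. y + p))"

definition a_chi :: "'a::euclidean_space set \<Rightarrow> 'a \<Rightarrow> 'a \<Rightarrow> real" where
  "a_chi \<Delta> l1 ch = Max ((\<lambda>\<alpha>. representation \<Delta> ch \<alpha> / representation \<Delta> l1 \<alpha>) ` \<Delta>)"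

definition I_chi :: "'a::euclidean_space set \<Rightarrow> 'a \<Rightarrow> 'a \<Rightarrow> 'a set" where
  "I_chi \<Delta> l1 ch = {\<alpha>\<in>\<Delta>. representation \<Delta> ch \<alpha> / representation \<Delta> l1 \<alpha> < a_chi \<Delta> l1 ch}"

definition b_chi :: "'a::euclidean_space set \<Rightarrow> 'a \<Rightarrow> 'a \<Rightarrow> nat" where
  "b_chi \<Delta> l1 ch = card (\<Delta> - I_chi \<Delta> l1 ch)"

definition ker_set :: "'a::euclidean_space set \<Rightarrow> 'a set" where
  "ker_set A = {a. \<forall>\<alpha>\<in>A. \<alpha> \<bullet> a = 0}"

definition d0_chi :: "'a::euclidean_space set \<Rightarrow> 'a \<Rightarrow> 'a \<Rightarrow> 'a set" where
  "d0_chi \<Delta> l1 ch = {a. ch \<bullet> a = 0} \<inter> ker_set (I_chi \<Delta> l1 ch)"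

definition supp_lam :: "'a::euclidean_space set \<Rightarrow> 'a \<Rightarrow> 'a \<Rightarrow> 'a set" where
  "supp_lam \<Delta> l1 li = {\<alpha>\<in>\<Delta>. representation \<Delta> (l1 - li) \<alpha> > 0}"

definition pos_chamber :: "'a::euclidean_space set \<Rightarrow> 'a set" where
  "pos_chamber \<Delta> = {a. \<forall>\<alpha>\<in>\<Delta>. \<alpha> \<bullet> a \<ge> 0}"

definition phi_map :: "nat \<Rightarrow> (nat \<Rightarrow> 'a::euclidean_space) \<Rightarrow> (nat \<Rightarrow> 'w::real_vector) \<Rightarrow> 'a \<Rightarrow> 'w" where
  "phi_map k lam w a = (\<Sum>i=1..k. exp (lam i \<bullet> a) *\<^sub>R w i)"

definition psi_map :: "'a::euclidean_space set \<Rightarrow> nat \<Rightarrow> (nat \<Rightarrow> 'a) \<Rightarrow> (nat \<Rightarrow> 'w::real_vector)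
    \<Rightarrow> 'a \<Rightarrow> 'a \<Rightarrow> 'w" where
  "psi_map \<Delta> k lam w ch a =
     (\<Sum>i\<in>{i\<in>{1..k}. supp_lam \<Delta> (lam 1) (lam i) \<subseteq> I_chi \<Delta> (lam 1) ch}. exp (lam i \<bullet> a) *\<^sub>R w i)"

text \<open>d^+ as a subset of the orthogonal complement of d0 (identified with a/d0).\<close>
definition dplus :: "'a::euclidean_space set \<Rightarrow> 'a \<Rightarrow> 'a \<Rightarrow> 'a set" where
  "dplus \<Delta> l1 ch = {x \<in> orthogonal_comp (d0_chi \<Delta> l1 ch). \<forall>\<alpha>\<in>I_chi \<Delta> l1 ch. \<alpha> \<bullet> x \<ge> 0}"

definition L_chi :: "'a::euclidean_space set \<Rightarrow> nat \<Rightarrow> (nat \<Rightarrow> 'a) \<Rightarrow> (nat \<Rightarrow> 'w::real_vector)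
    \<Rightarrow> 'a \<Rightarrow> ('w \<Rightarrow> real) \<Rightarrow> real" where
  "L_chi \<Delta> k lam w ch f =
     set_lebesgue_integral (subspace_measure (orthogonal_comp (d0_chi \<Delta> (lam 1) ch)))
       (dplus \<Delta> (lam 1) ch) (\<lambda>x. f (psi_map \<Delta> k lam w ch x) * exp (ch \<bullet> x))"

definition kappa_chi :: "'a::euclidean_space set \<Rightarrow> 'a \<Rightarrow> 'a \<Rightarrow> real" where
  "kappa_chi \<Delta> l1 ch =
     (let A = ker_set (I_chi \<Delta> l1 ch) \<inter> {a. l1 \<bullet> a = 1}
      in measure (affine_measure A) (pos_chamber \<Delta> \<inter> A))"

end

theory Submission
  imports Defs
begin

text \<open>Put \<open>L = ln T\<close>, let \<open>D\<close> be \<open>d0_chi\<close>, and pick \<open>p\<close> in the common kernel of \<open>I_chi\<close> with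
  \<open>\<lambda>\<^sub>1(p) = 1\<close>. Substitute \<open>a = L p + x + L y\<close> with \<open>y\<close> in \<open>D\<close> and \<open>x\<close> orthogonal to \<open>D\<close>.
  On \<open>p + D\<close> the functional \<open>\<chi>\<close> is the constant \<open>a_chi\<close>, so the weight becomes
  \<open>T powr a_chi * exp (\<chi>(x))\<close>, and the Jacobian is \<open>L ^ dim D = L ^ (b_chi - 1)\<close>. As \<open>L\<close> grows,
  the exponentials whose support leaves \<open>I_chi\<close> vanish whenever \<open>p + y\<close> is interior to the chamber,
  and the integrand tends to the product of the integrand of \<open>L_chi\<close> in \<open>x\<close> and the
  indicator defining \<open>kappa_chi\<close> in \<open>y\<close>. Dominated convergence applies since on the support of \<open>f\<close>
  \<open>\<lambda>\<^sub>1(x)\<close> is bounded above, whence \<open>\<chi>(x) \<le> C - \<epsilon> |x|\<close>, while \<open>|y|\<close> is at most linear in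
  \<open>|x|\<close>.\<close>

section \<open>Norm bounds from separating functionals\<close>

text \<open>The inner product of \<open>F x\<close> with \<open>x\<close> is the sum of the squares
  of \<open>v \<bullet> x\<close>, so the linear map \<open>F\<close> is injective on
  \<open>S\<close> and hence bounded below there; its norm is in turn controlled by the values of
  the functionals. It is applied to \<open>lam 1\<close> with \<open>I\<close> on the orthogonal
  complement of \<open>D\<close>, and to \<open>\<Delta>\<close> on the whole space.\<close>

lemma isometric_functionals:
  fixes B :: "'a::euclidean_space set"
  assumes S: "subspace S" and fin: "finite B"
    and inj: "\<And>x. x \<in> S \<Longrightarrow> (\<And>v. v \<in> B \<Longrightarrow> v \<bullet> x = 0) \<Longrightarrow> x = 0"
  obtains e where "e > 0" "\<And>x. x \<in> S \<Longrightarrow> e * norm x \<le> (\<Sum>v\<in>B. \<bar>v \<bullet> x\<bar>)"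
proof -
  define F where "F x = (\<Sum>v\<in>B. (v \<bullet> x) *\<^sub>R v)" for x
  have "linear F"
    unfolding F_def
    by (intro linearI)
      (simp_all add: inner_add_right scaleR_add_left sum.distrib scaleR_sum_right)
  have "\<exists>e>0. \<forall>x\<in>S. e * norm x \<le> norm (F x)"
  proof (rule injective_imp_isometric)
    show "closed S" by (rule closed_subspace[OF S])
    show "bounded_linear F" using \<open>linear F\<close> by (simp add: linear_conv_bounded_linear)
    show "\<forall>x\<in>S. F x = 0 \<longrightarrow> x = 0"
    proof (intro ballI impI)
      fix x assume x: "x \<in> S" "F x = 0"
      have "(\<Sum>v\<in>B. (v \<bullet> x)\<^sup>2) = F x \<bullet> x"
        by (simp add: F_def inner_sum_left power2_eq_square)
      also have "\<dots> = 0" using x by simp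
      finally have "\<And>v. v \<in> B \<Longrightarrow> v \<bullet> x = 0"
        using fin by (subst (asm) sum_nonneg_eq_0_iff) auto
      then show "x = 0" using inj x by blast
    qed
  qed (rule S)
  then obtain e where e: "e > 0" "\<And>x. x \<in> S \<Longrightarrow> e * norm x \<le> norm (F x)" by blast
  \<comment> \<open>The summand 1 keeps \<open>K\<close> positive, so that dividing by it is allowed
    even when \<open>B\<close> is empty.\<close>
  define K where "K = 1 + (\<Sum>v\<in>B. norm v)"
  have K1: "K > 0" unfolding K_def by (intro add_pos_nonneg sum_nonneg) auto
  have K2: "norm v \<le> K" if "v \<in> B" for v
    using member_le_sum[of v B norm] that fin by (simp add: K_def)
  have "norm (F x) \<le> K * (\<Sum>v\<in>B. \<bar>v \<bullet> x\<bar>)" for x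
  proof -
    have "norm (F x) \<le> (\<Sum>v\<in>B. norm ((v \<bullet> x) *\<^sub>R v))"
      unfolding F_def by (rule norm_sum)
    also have "\<dots> \<le> (\<Sum>v\<in>B. K * \<bar>v \<bullet> x\<bar>)"
      by (rule sum_mono) (use K2 in \<open>simp add: mult.commute mult_right_mono\<close>)
    finally show ?thesis by (simp add: sum_distrib_left)
  qed
  then have "(e / K) * norm x \<le> (\<Sum>v\<in>B. \<bar>v \<bullet> x\<bar>)" if "x \<in> S" for x
    using order_trans[OF e(2)[OF that], of "K * (\<Sum>v\<in>B. \<bar>v \<bullet> x\<bar>)"] K1
    by (simp add: divide_le_eq mult.commute)
  moreover have "e / K > 0" using e(1) K1 by simp
  ultimately show ?thesis using that by blast
qed

section \<open>Translation invariant measures\<close>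

text \<open>On the ball of radius \<open>n\<close> the Gaussian is at least
  \<open>exp (- n\<^sup>2)\<close>, so a finite Gaussian integral makes every ball finite, and the
  balls exhaust the space.\<close>

lemma sigma_finite_gaussian:
  fixes M :: "'a::euclidean_space measure"
  assumes [measurable_cong]: "sets M = sets borel"
    and fin: "(\<integral>\<^sup>+x. ennreal (exp (- (norm x)\<^sup>2)) \<partial>M) < \<infinity>"
  shows "sigma_finite_measure M"
proof
  have sp: "space M = UNIV" using sets_eq_imp_space_eq[OF assms(1)] by simp
  show "\<exists>A. countable A \<and> A \<subseteq> sets M \<and> \<Union>A = space M \<and> (\<forall>a\<in>A. emeasure M a \<noteq> \<infinity>)"
  proof (intro exI[of _ "range (\<lambda>n::nat. cball 0 (real n))"] conjI ballI)
    show "\<Union> (range (\<lambda>n. cball (0::'a) (real n))) = space M"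
      by (auto simp: sp real_arch_simple)
    show "countable (range (\<lambda>n::nat. cball (0::'a) (real n)))" by simp
    show "range (\<lambda>n::nat. cball (0::'a) (real n)) \<subseteq> sets M" by (auto simp: assms(1))
    fix a assume "a \<in> range (\<lambda>n::nat. cball (0::'a) (real n))"
    then obtain n where a: "a = cball 0 (real n)" by auto
    have "emeasure M a = (\<integral>\<^sup>+x. indicator a x \<partial>M)"
      by (simp add: assms(1) a)
    also have "\<dots> \<le> (\<integral>\<^sup>+x. ennreal (exp ((real n)\<^sup>2)) * ennreal (exp (- (norm x)\<^sup>2)) \<partial>M)"
    proof (rule nn_integral_mono)
      fix x
      show "indicator a x \<le> ennreal (exp ((real n)\<^sup>2)) * ennreal (exp (- (norm x)\<^sup>2))"
      proof (cases "x \<in> a")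
        case True
        then have "(norm x)\<^sup>2 \<le> (real n)\<^sup>2" by (intro power_mono) (auto simp: a)
        then show ?thesis
          using True by (simp add: ennreal_mult[symmetric] exp_add[symmetric])
      qed simp
    qed
    also have "\<dots> = ennreal (exp ((real n)\<^sup>2)) * (\<integral>\<^sup>+x. ennreal (exp (- (norm x)\<^sup>2)) \<partial>M)"
      by (rule nn_integral_cmult) simp
    also have "\<dots> < \<infinity>" using fin by (simp add: ennreal_mult_less_top)
    finally show "emeasure M a \<noteq> \<infinity>" by simp
  qed
qed

text \<open>Uniqueness of Haar measure: both sides equal the integral of
  \<open>exp (- |x|\<^sup>2) 1\<^sub>A(x + y)\<close> over the product measure.\<close>
lemma translation_invariant_eq_lborel:
  fixes M :: "'a::euclidean_space measure"
  assumes sets[measurable_cong]: "sets M = sets borel"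
    and fin: "(\<integral>\<^sup>+x. ennreal (exp (- (norm x)\<^sup>2)) \<partial>M) < \<infinity>"
    and inv: "\<And>F s. F \<in> borel_measurable borel \<Longrightarrow> (\<integral>\<^sup>+x. F (x + s) \<partial>M) = (\<integral>\<^sup>+x. F x \<partial>M)"
    and A[measurable]: "A \<in> sets borel"
  shows "(\<integral>\<^sup>+x. ennreal (exp (- (norm x)\<^sup>2)) \<partial>M) * emeasure lborel A
       = (\<integral>\<^sup>+x. ennreal (exp (- (norm (x::'a))\<^sup>2)) \<partial>lborel) * emeasure M A"
proof -
  interpret M: sigma_finite_measure M by (rule sigma_finite_gaussian[OF sets fin])
  interpret P: pair_sigma_finite M lborel ..
  define g :: "'a \<Rightarrow> ennreal" where "g x = ennreal (exp (- (norm x)\<^sup>2))" for x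
  have [measurable]: "g \<in> borel_measurable borel" unfolding g_def by measurable
  have lb: "(\<integral>\<^sup>+y. F (y + s) \<partial>lborel) = (\<integral>\<^sup>+y. F y \<partial>lborel)"
    if [measurable]: "F \<in> borel_measurable borel" for F and s :: 'a
    by (subst (2) lborel_distr_plus[symmetric, of s]) (simp add: nn_integral_distr add.commute)
  have "(\<integral>\<^sup>+x. g x \<partial>M) * emeasure lborel A = (\<integral>\<^sup>+x. g x * (\<integral>\<^sup>+y. indicator A y \<partial>lborel) \<partial>M)"
    by (simp add: nn_integral_multc)
  also have "\<dots> = (\<integral>\<^sup>+x. g x * (\<integral>\<^sup>+y. indicator A (y + x) \<partial>lborel) \<partial>M)"
    by (subst lb) simp_all
  also have "\<dots> = (\<integral>\<^sup>+x. \<integral>\<^sup>+y. g x * indicator A (y + x) \<partial>lborel \<partial>M)"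
    by (subst nn_integral_cmult) simp_all
  also have "\<dots> = (\<integral>\<^sup>+y. \<integral>\<^sup>+x. g x * indicator A (y + x) \<partial>M \<partial>lborel)"
    by (rule P.Fubini'[symmetric]) measurable
  \<comment> \<open>Invariance of \<open>M\<close> moves the shift from \<open>A\<close> to the
    Gaussian. After the second exchange the Gaussian is integrated over \<open>y\<close>, where its
    symmetry and the invariance of \<open>lborel\<close> remove the shift.\<close>
  also have "\<dots> = (\<integral>\<^sup>+y. \<integral>\<^sup>+x. g (x - y) * indicator A x \<partial>M \<partial>lborel)"
  proof (rule nn_integral_cong)
    fix y :: 'a
    show "(\<integral>\<^sup>+x. g x * indicator A (y + x) \<partial>M) = (\<integral>\<^sup>+x. g (x - y) * indicator A x \<partial>M)"
      using inv[of "\<lambda>x. g (x - y) * indicator A x" y] by (simp add: add.commute)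
  qed
  also have "\<dots> = (\<integral>\<^sup>+x. \<integral>\<^sup>+y. g (x - y) * indicator A x \<partial>lborel \<partial>M)"
    by (rule P.Fubini') measurable
  also have "\<dots> = (\<integral>\<^sup>+x. (\<integral>\<^sup>+y. g (y + (- x)) \<partial>lborel) * indicator A x \<partial>M)"
    by (subst nn_integral_multc) (simp_all add: g_def norm_minus_commute)
  also have "\<dots> = (\<integral>\<^sup>+x. (\<integral>\<^sup>+y. g y \<partial>lborel) * indicator A x \<partial>M)"
    by (subst lb) simp_all
  also have "\<dots> = (\<integral>\<^sup>+y. g y \<partial>lborel) * emeasure M A"
    by (subst nn_integral_cmult) (simp_all add: sets)
  finally show ?thesis unfolding g_def .
qed

section \<open>The Gaussian integral as a normalising constant\<close>

text \<open>For positive \<open>c\<close> this is the square root of pi divided by \<open>c\<close>.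
  The value is never computed: positivity, finiteness and the scaling law suffice.\<close>

definition gauss :: "real \<Rightarrow> ennreal" where
  "gauss c = (\<integral>\<^sup>+x. ennreal (exp (- (c * x)\<^sup>2)) \<partial>lborel)"

lemma integrable_inverse_square: "integrable lborel (\<lambda>x::real. inverse (1 + x\<^sup>2))"
  using integrable_inverse_1_plus_square by (simp add: set_integrable_def einterval_def)

lemma gauss_finite: "gauss 1 < \<infinity>"
proof -
  have "gauss 1 \<le> (\<integral>\<^sup>+x. ennreal (inverse (1 + x\<^sup>2)) \<partial>lborel)"
    unfolding gauss_def
  proof (intro nn_integral_mono ennreal_leI)
    fix x :: real
    have "1 + x\<^sup>2 \<le> exp (x\<^sup>2)" by (rule exp_ge_add_one_self)
    then show "exp (- (1 * x)\<^sup>2) \<le> inverse (1 + x\<^sup>2)"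
      by (simp add: exp_minus le_imp_inverse_le add_pos_nonneg)
  qed
  also have "\<dots> < \<infinity>"
    using integrable_inverse_square by (simp add: integrable_iff_bounded)
  finally show ?thesis .
qed

lemma gauss_pos: "gauss 1 > 0"
proof (rule ccontr)
  assume "\<not> ?thesis"
  then have "AE x in lborel. ennreal (exp (- (1 * x)\<^sup>2)) = 0"
    unfolding gauss_def by (subst nn_integral_0_iff_AE[symmetric]) auto
  then have "AE x in lborel. (x::real) \<in> {}"
    by eventually_elim simp
  then have "emeasure lborel (UNIV :: real set) = 0"
    by (subst (asm) AE_iff_measurable[of UNIV]) auto
  then show False by simp
qed

lemma gauss_scale: "c > 0 \<Longrightarrow> gauss 1 = ennreal c * gauss c"
  unfolding gauss_def by (subst nn_integral_real_affine[of _ c 0]) auto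

lemma gaussian_lborel:
  "(\<integral>\<^sup>+x. ennreal (exp (- (norm (x::'a::euclidean_space))\<^sup>2)) \<partial>lborel) = gauss 1 ^ DIM('a)"
proof -
  have norm: "(norm x)\<^sup>2 = (\<Sum>b\<in>Basis. (x \<bullet> b)\<^sup>2)" for x :: 'a
    unfolding power2_norm_eq_inner by (subst euclidean_inner) (simp add: power2_eq_square)
  have "(\<integral>\<^sup>+x. ennreal (exp (- (norm (x::'a))\<^sup>2)) \<partial>lborel)
     = (\<integral>\<^sup>+x. (\<Prod>b\<in>Basis. ennreal (exp (- (1 * (x \<bullet> b))\<^sup>2))) \<partial>(lborel :: 'a measure))"
    by (intro nn_integral_cong)
      (simp add: prod_ennreal exp_sum[symmetric] sum_negf norm)
  also have "\<dots> = gauss 1 ^ DIM('a)"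
    by (subst nn_integral_lborel_prod) (auto simp: gauss_def)
  finally show ?thesis .
qed

section \<open>Lebesgue measure on a subspace\<close>

definition orthonormal_frame :: "'a::euclidean_space set \<Rightarrow> (nat \<Rightarrow> 'a) \<Rightarrow> bool" where
  "orthonormal_frame S e \<longleftrightarrow> (\<forall>i<dim S. e i \<in> S)
     \<and> (\<forall>i<dim S. \<forall>j<dim S. e i \<bullet> e j = (if i = j then 1 else 0))
     \<and> (\<forall>y\<in>S. y = (\<Sum>i<dim S. (y \<bullet> e i) *\<^sub>R e i))"

lemma orthonormal_frameD:
  assumes "orthonormal_frame S e"
  shows "i < dim S \<Longrightarrow> e i \<in> S"
    and "i < dim S \<Longrightarrow> j < dim S \<Longrightarrow> e i \<bullet> e j = (if i = j then 1 else 0)"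
    and "y \<in> S \<Longrightarrow> y = (\<Sum>i<dim S. (y \<bullet> e i) *\<^sub>R e i)"
  using assms[unfolded orthonormal_frame_def, THEN conjunct1]
    assms[unfolded orthonormal_frame_def, THEN conjunct2, THEN conjunct1]
    assms[unfolded orthonormal_frame_def, THEN conjunct2, THEN conjunct2, THEN bspec]
  by blast+

text \<open>The definition chooses its frame by \<open>SOME\<close>. Enumerating an orthonormal
  basis shows that a frame exists, so the chosen one is orthonormal; the integrals against this
  measure are all computed in the frame obtained here.\<close>

lemma subspace_measure_eq:
  fixes S :: "'a::euclidean_space set"
  assumes S: "subspace S"
  shows "\<exists>e. orthonormal_frame S e \<and>
    subspace_measure S = distr (PiM {..<dim S} (\<lambda>_. lborel)) borel (\<lambda>x. \<Sum>i<dim S. x i *\<^sub>R e i)"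
proof -
  let ?P = "\<lambda>e. (\<forall>i<dim S. e i \<in> S) \<and>
                 (\<forall>i<dim S. \<forall>j<dim S. e i \<bullet> e j = (if i = j then 1 else (0::real)))"
  obtain B where B: "B \<subseteq> S" "pairwise orthogonal B" "\<And>x. x \<in> B \<Longrightarrow> norm x = 1"
      "independent B" "card B = dim S" "span B = S"
    using orthonormal_basis_subspace[OF S] by metis
  have "finite B" using B(4) by (rule independent_imp_finite)
  then obtain e0 where e0: "bij_betw e0 {..<dim S} B"
    by (metis B(5) ex_bij_betw_nat_finite atLeast0LessThan)
  have "?P e0"
  proof (intro conjI allI impI)
    fix i assume i: "i < dim S"
    then have ei: "e0 i \<in> B" using e0 by (auto simp: bij_betw_def)
    then show "e0 i \<in> S" using B by auto
    fix j assume j: "j < dim S"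
    then have ej: "e0 j \<in> B" using e0 by (auto simp: bij_betw_def)
    show "e0 i \<bullet> e0 j = (if i = j then 1 else 0)"
    proof (cases "i = j")
      case True then show ?thesis using B(3)[OF ei] by (simp add: norm_eq_1)
    next
      case False
      then have "e0 i \<noteq> e0 j" using e0 i j by (auto simp: bij_betw_def inj_on_def)
      then show ?thesis using False B(2) ei ej by (auto simp: pairwise_def orthogonal_def)
    qed
  qed
  define e where "e = (SOME e. ?P e)"
  have e: "?P e" unfolding e_def by (rule someI[of ?P, OF \<open>?P e0\<close>])
  have inj: "inj_on e {..<dim S}"
    using e by (auto simp: inj_on_def) (metis zero_neq_one)
  have "0 \<notin> e ` {..<dim S}" using e by force
  moreover have "pairwise orthogonal (e ` {..<dim S})"
    using e by (auto simp: pairwise_def orthogonal_def)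
  ultimately have ind: "independent (e ` {..<dim S})"
    by (simp add: pairwise_orthogonal_independent)
  \<comment> \<open>Independent vectors of \<open>S\<close>, as many as its dimension, span it;
    hence every \<open>y\<close> in \<open>S\<close> has an expansion, whose coefficients
    orthonormality identifies.\<close>
  have "S \<subseteq> span (e ` {..<dim S})"
    using ind e by (intro card_ge_dim_independent) (auto simp: card_image inj)
  then have exp: "y = (\<Sum>i<dim S. (y \<bullet> e i) *\<^sub>R e i)" if "y \<in> S" for y
  proof -
    have "y \<in> span (e ` {..<dim S})" using \<open>S \<subseteq> _\<close> that by auto
    then obtain u where "y = (\<Sum>v\<in>e ` {..<dim S}. u v *\<^sub>R v)"
      by (auto simp: span_finite)
    then have y: "y = (\<Sum>i<dim S. u (e i) *\<^sub>R e i)" by (simp add: sum.reindex inj)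
    have "y \<bullet> e j = u (e j)" if "j < dim S" for j
    proof -
      have "y \<bullet> e j = (\<Sum>i<dim S. u (e i) * (if i = j then 1 else 0))"
        by (subst y, subst inner_sum_left) (use e that in \<open>intro sum.cong; simp\<close>)
      then show ?thesis using that by (simp add: sum.delta if_distrib cong: if_cong)
    qed
    then show ?thesis using y by simp
  qed
  show ?thesis
    using e exp by (intro exI[of _ e]) (simp add: orthonormal_frame_def subspace_measure_def e_def Let_def)
qed

lemma sets_subspace_measure[measurable_cong, simp]: "sets (subspace_measure S) = sets borel"
  by (simp add: subspace_measure_def Let_def)

lemma space_subspace_measure[simp]: "space (subspace_measure S) = UNIV"
  by (simp add: subspace_measure_def Let_def)

lemma product_sigma_finite_lborel: "product_sigma_finite (\<lambda>_::nat. lborel :: real measure)"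
  by standard

text \<open>A product measure is determined by boxes, and the preimage of a box is the box of
  translated sides. The restricted lambda keeps the shifted function in the space of the
  product.\<close>

lemma PiM_lborel_translation:
  fixes t :: "nat \<Rightarrow> real"
  shows "distr (PiM {..<d} (\<lambda>_. lborel)) (PiM {..<d} (\<lambda>_. lborel)) (\<lambda>x. \<lambda>i\<in>{..<d}. x i + t i)
       = PiM {..<d} (\<lambda>_. lborel)"
proof -
  interpret product_sigma_finite "\<lambda>_::nat. lborel :: real measure"
    by (rule product_sigma_finite_lborel)
  show ?thesis
  proof (rule PiM_eqI)
    fix A :: "nat \<Rightarrow> real set" assume A: "\<And>i. i \<in> {..<d} \<Longrightarrow> A i \<in> sets lborel"
    have A': "(\<lambda>x. x + t i) -` A i \<in> sets lborel" if "i \<in> {..<d}" for i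
      using measurable_sets[of "\<lambda>x. x + t i" lborel lborel "A i"] A[OF that] by simp
    have "(\<lambda>x. \<lambda>i\<in>{..<d}. x i + t i) -` Pi\<^sub>E {..<d} A \<inter> space (PiM {..<d} (\<lambda>_. lborel))
        = Pi\<^sub>E {..<d} (\<lambda>i. (\<lambda>x. x + t i) -` A i)"
      by (auto simp: space_PiM PiE_def Pi_def)
    then have "emeasure (distr (PiM {..<d} (\<lambda>_. lborel)) (PiM {..<d} (\<lambda>_. lborel)) (\<lambda>x. \<lambda>i\<in>{..<d}. x i + t i)) (Pi\<^sub>E {..<d} A)
       = emeasure (PiM {..<d} (\<lambda>_. lborel)) (Pi\<^sub>E {..<d} (\<lambda>i. (\<lambda>x. x + t i) -` A i))"
      using A by (subst emeasure_distr) (auto intro!: sets_PiM_I_finite)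
    also have "\<dots> = (\<Prod>i<d. emeasure lborel ((\<lambda>x. x + t i) -` A i))"
      using A' by (subst emeasure_PiM) auto
    also have "\<dots> = (\<Prod>i<d. emeasure lborel (A i))"
    proof (rule prod.cong)
      fix i assume "i \<in> {..<d}"
      then have "emeasure (distr lborel borel ((+) (t i))) (A i) = emeasure lborel ((\<lambda>x. x + t i) -` A i)"
        using A by (subst emeasure_distr) (auto simp: add.commute[of _ "t i"])
      then show "emeasure lborel ((\<lambda>x. x + t i) -` A i) = emeasure lborel (A i)"
        by (simp add: lborel_distr_plus)
    qed simp
    finally show "emeasure (distr (PiM {..<d} (\<lambda>_. lborel)) (PiM {..<d} (\<lambda>_. lborel)) (\<lambda>x. \<lambda>i\<in>{..<d}. x i + t i)) (Pi\<^sub>E {..<d} A)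
       = (\<Prod>i<d. emeasure lborel (A i))" .
  qed simp_all
qed

context
  fixes S :: "'a::euclidean_space set"
  assumes S: "subspace S"
begin

text \<open>In frame coordinates, adding \<open>s\<close> shifts coordinate \<open>i\<close> by
  \<open>s \<bullet> e i\<close>, which reduces the claim to the product measure.\<close>

lemma nn_integral_subspace_measure_translation:
  assumes s: "s \<in> S" and [measurable]: "F \<in> borel_measurable borel"
  shows "(\<integral>\<^sup>+y. F (y + s) \<partial>subspace_measure S) = (\<integral>\<^sup>+y. F y \<partial>subspace_measure S)"
proof -
  obtain e where fr: "orthonormal_frame S e"
    and M: "subspace_measure S = distr (PiM {..<dim S} (\<lambda>_. lborel)) borel (\<lambda>x. \<Sum>i<dim S. x i *\<^sub>R e i)"
    using subspace_measure_eq[OF S] by blast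
  note e = orthonormal_frameD[OF fr]
  let ?P = "PiM {..<dim S} (\<lambda>_. lborel :: real measure)"
  have "(\<integral>\<^sup>+y. F y \<partial>subspace_measure S) = (\<integral>\<^sup>+x. F (\<Sum>i<dim S. x i *\<^sub>R e i) \<partial>?P)"
    by (simp add: M nn_integral_distr)
  also have "\<dots> = (\<integral>\<^sup>+x. F (\<Sum>i<dim S. x i *\<^sub>R e i)
      \<partial>distr ?P ?P (\<lambda>x. \<lambda>i\<in>{..<dim S}. x i + s \<bullet> e i))"
    by (simp add: PiM_lborel_translation)
  also have "\<dots> = (\<integral>\<^sup>+x. F (\<Sum>i<dim S. (x i + s \<bullet> e i) *\<^sub>R e i) \<partial>?P)"
    by (subst nn_integral_distr)
      (auto intro!: measurable_restrict nn_integral_cong arg_cong[of _ _ F] sum.cong)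
  also have "\<dots> = (\<integral>\<^sup>+x. F ((\<Sum>i<dim S. x i *\<^sub>R e i) + s) \<partial>?P)"
    by (subst (2) e(3)[OF s]) (simp add: scaleR_add_left sum.distrib)
  also have "\<dots> = (\<integral>\<^sup>+y. F (y + s) \<partial>subspace_measure S)"
    by (simp add: M nn_integral_distr)
  finally show ?thesis by simp
qed

text \<open>The measure lives on the Borel sets of the ambient space; its concentration on
  \<open>S\<close> is what allows membership in \<open>S\<close> to be used under integrals.\<close>

lemma AE_subspace_measure: "AE y in subspace_measure S. y \<in> S"
proof -
  obtain e where fr: "orthonormal_frame S e"
    and M: "subspace_measure S = distr (PiM {..<dim S} (\<lambda>_. lborel)) borel (\<lambda>x. \<Sum>i<dim S. x i *\<^sub>R e i)"
    using subspace_measure_eq[OF S] by blast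
  note e = orthonormal_frameD[OF fr]
  have [measurable]: "S \<in> sets borel" using closed_subspace[OF S] by simp
  show ?thesis unfolding M
    by (subst AE_distr_iff) (auto intro!: AE_I2 subspace_sum S subspace_scale e(1))
qed

text \<open>Orthonormality makes \<open>x \<bullet> e i\<close> the \<open>i\<close>-th coordinate,
  and Tonelli separates the coordinates. Both the Gaussian integral and the integrability of
  \<open>exp (- \<epsilon> * norm x)\<close> come from this formula.\<close>

lemma nn_integral_subspace_measure_prod:
  fixes f :: "real \<Rightarrow> ennreal"
  assumes [measurable]: "f \<in> borel_measurable borel"
  obtains e where
    "\<And>i. i < dim S \<Longrightarrow> norm (e i) = 1"
    "\<And>x. x \<in> S \<Longrightarrow> (norm x)\<^sup>2 = (\<Sum>i<dim S. (x \<bullet> e i)\<^sup>2)"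
    "(\<integral>\<^sup>+x. (\<Prod>i<dim S. f (x \<bullet> e i)) \<partial>subspace_measure S) = (\<integral>\<^sup>+x. f x \<partial>lborel) ^ dim S"
proof -
  interpret product_sigma_finite "\<lambda>_::nat. lborel :: real measure"
    by (rule product_sigma_finite_lborel)
  obtain e where fr: "orthonormal_frame S e"
    and M: "subspace_measure S = distr (PiM {..<dim S} (\<lambda>_. lborel)) borel (\<lambda>x. \<Sum>i<dim S. x i *\<^sub>R e i)"
    using subspace_measure_eq[OF S] by blast
  note e = orthonormal_frameD[OF fr]
  have co: "(\<Sum>i<dim S. x i *\<^sub>R e i) \<bullet> e j = x j" if "j < dim S" for x j
  proof -
    have "(\<Sum>i<dim S. x i *\<^sub>R e i) \<bullet> e j = (\<Sum>i<dim S. x i * (if i = j then 1 else 0))"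
      by (subst inner_sum_left) (use e(2) that in \<open>intro sum.cong; simp\<close>)
    then show ?thesis using that by (simp add: sum.delta if_distrib cong: if_cong)
  qed
  show ?thesis
  proof (rule that[of e])
    show "norm (e i) = 1" if "i < dim S" for i using e(2) that by (simp add: norm_eq_1)
    show "(norm x)\<^sup>2 = (\<Sum>i<dim S. (x \<bullet> e i)\<^sup>2)" if "x \<in> S" for x
      unfolding power2_norm_eq_inner
      by (subst (2) e(3)[OF that]) (simp add: inner_sum_right power2_eq_square)
    have "(\<integral>\<^sup>+x. (\<Prod>i<dim S. f (x \<bullet> e i)) \<partial>subspace_measure S)
       = (\<integral>\<^sup>+x. (\<Prod>i<dim S. f (x i)) \<partial>PiM {..<dim S} (\<lambda>_. lborel))"
      unfolding M by (subst nn_integral_distr) (auto simp: co intro!: nn_integral_cong prod.cong)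
    also have "\<dots> = (\<integral>\<^sup>+x. f x \<partial>lborel) ^ dim S"
      by (subst product_nn_integral_prod) auto
    finally show "(\<integral>\<^sup>+x. (\<Prod>i<dim S. f (x \<bullet> e i)) \<partial>subspace_measure S) = (\<integral>\<^sup>+x. f x \<partial>lborel) ^ dim S" .
  qed
qed

lemma gaussian_subspace_measure:
  "(\<integral>\<^sup>+x. ennreal (exp (- (norm (c *\<^sub>R x))\<^sup>2)) \<partial>subspace_measure S) = gauss c ^ dim S"
proof -
  obtain e where e: "\<And>x. x \<in> S \<Longrightarrow> (norm x)\<^sup>2 = (\<Sum>i<dim S. (x \<bullet> e i)\<^sup>2)"
    "(\<integral>\<^sup>+x. (\<Prod>i<dim S. ennreal (exp (- (c * (x \<bullet> e i))\<^sup>2))) \<partial>subspace_measure S) = gauss c ^ dim S"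
  proof (rule nn_integral_subspace_measure_prod[of "\<lambda>x. ennreal (exp (- (c * x)\<^sup>2))"])
    show "(\<lambda>x. ennreal (exp (- (c * x)\<^sup>2))) \<in> borel_measurable borel" by measurable
  qed (unfold gauss_def, blast)
  have "(\<integral>\<^sup>+x. ennreal (exp (- (norm (c *\<^sub>R x))\<^sup>2)) \<partial>subspace_measure S)
      = (\<integral>\<^sup>+x. (\<Prod>i<dim S. ennreal (exp (- (c * (x \<bullet> e i))\<^sup>2))) \<partial>subspace_measure S)"
    by (rule nn_integral_cong_AE, use AE_subspace_measure in eventually_elim)
      (simp add: prod_ennreal exp_sum[symmetric] sum_negf power_mult_distrib e(1) sum_distrib_left)
  then show ?thesis using e(2) by simp
qed

lemma sigma_finite_subspace_measure: "sigma_finite_measure (subspace_measure S)"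
proof (rule sigma_finite_gaussian)
  have "(\<integral>\<^sup>+x. ennreal (exp (- (norm x)\<^sup>2)) \<partial>subspace_measure S) = gauss 1 ^ dim S"
    using gaussian_subspace_measure[of 1] by simp
  also have "\<dots> < \<infinity>" using gauss_finite by (simp add: power_less_top_ennreal)
  finally show "(\<integral>\<^sup>+x. ennreal (exp (- (norm x)\<^sup>2)) \<partial>subspace_measure S) < \<infinity>" .
qed simp

text \<open>A null measure would make the Gaussian integral 0, but it is a power of the positive
  number \<open>gauss 1\<close>. This is used to extract an actual point from an almost everywhere
  statement.\<close>

lemma subspace_measure_UNIV_nonzero: "emeasure (subspace_measure S) UNIV \<noteq> 0"
proof
  assume "emeasure (subspace_measure S) UNIV = 0"
  then have "AE x in subspace_measure S. False"
    by (subst AE_iff_measurable[of UNIV]) auto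
  then have "(\<integral>\<^sup>+x. ennreal (exp (- (norm (1 *\<^sub>R x))\<^sup>2)) \<partial>subspace_measure S) = (\<integral>\<^sup>+x. 0 \<partial>subspace_measure S)"
    by (intro nn_integral_cong_AE) auto
  then show False using gaussian_subspace_measure[of 1] gauss_pos by simp
qed

text \<open>The norm dominates each coordinate, so the exponential is at most a product of
  one-dimensional exponentials, each integrable by comparison with
  \<open>inverse (1 + x\<^sup>2)\<close>.\<close>

lemma integrable_exp_norm_subspace_measure:
  assumes "\<epsilon> > 0"
  shows "integrable (subspace_measure S) (\<lambda>x. exp (- \<epsilon> * norm x))"
proof -
  \<comment> \<open>The rate is shared among the coordinates; the \<open>+ 1\<close> covers
    dimension 0.\<close>
  define \<delta> where "\<delta> = \<epsilon> / (dim S + 1)"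
  have \<delta>: "\<delta> > 0" using assms by (simp add: \<delta>_def)
  obtain e where e: "\<And>i. i < dim S \<Longrightarrow> norm (e i) = 1"
    "(\<integral>\<^sup>+x. (\<Prod>i<dim S. ennreal (exp (- \<delta> * \<bar>x \<bullet> e i\<bar>))) \<partial>subspace_measure S)
      = (\<integral>\<^sup>+x. ennreal (exp (- \<delta> * \<bar>x\<bar>)) \<partial>lborel) ^ dim S"
  proof (rule nn_integral_subspace_measure_prod[of "\<lambda>x. ennreal (exp (- \<delta> * \<bar>x\<bar>))"])
    show "(\<lambda>x. ennreal (exp (- \<delta> * \<bar>x\<bar>))) \<in> borel_measurable borel" by measurable
  qed blast
  \<comment> \<open>Chosen so that \<open>1 + x\<^sup>2 \<le> C * (1 + \<delta>\<^sup>2 * x\<^sup>2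
    / 2)\<close>, the last factor being a Taylor lower bound of the exponential.\<close>
  define C where "C = 1 + 2 / \<delta>\<^sup>2"
  have "exp (- \<delta> * \<bar>x\<bar>) \<le> C * inverse (1 + x\<^sup>2)" for x :: real
  proof -
    have "1 + \<delta> * \<bar>x\<bar> + (\<delta> * \<bar>x\<bar>)\<^sup>2 / 2 \<le> exp (\<delta> * \<bar>x\<bar>)"
      using \<delta> by (intro exp_lower_Taylor_quadratic) auto
    then have l: "1 + \<delta>\<^sup>2 * x\<^sup>2 / 2 \<le> exp (\<delta> * \<bar>x\<bar>)"
      using \<delta> by (simp add: power_mult_distrib) (smt (verit) mult_nonneg_nonneg)
    have "1 + x\<^sup>2 \<le> C * (1 + \<delta>\<^sup>2 * x\<^sup>2 / 2)"
      using \<delta> by (simp add: C_def field_simps)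
    also have "\<dots> \<le> C * exp (\<delta> * \<bar>x\<bar>)" using l by (intro mult_left_mono) (auto simp: C_def)
    finally show ?thesis
      by (simp add: exp_minus field_simps add_pos_nonneg)
  qed
  then have "(\<integral>\<^sup>+x. ennreal (exp (- \<delta> * \<bar>x\<bar>)) \<partial>lborel) \<le> (\<integral>\<^sup>+x. ennreal (C * inverse (1 + x\<^sup>2)) \<partial>lborel)"
    by (intro nn_integral_mono ennreal_leI)
  also have "\<dots> < \<infinity>"
    using nn_integral_eq_integral[OF integrable_mult_right[OF integrable_inverse_square, of C]]
    by (simp add: C_def)
  finally have fin: "(\<integral>\<^sup>+x. ennreal (exp (- \<delta> * \<bar>x\<bar>)) \<partial>lborel) < \<infinity>" .
  have "(\<integral>\<^sup>+x. ennreal (exp (- \<epsilon> * norm x)) \<partial>subspace_measure S)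
     \<le> (\<integral>\<^sup>+x. (\<Prod>i<dim S. ennreal (exp (- \<delta> * \<bar>x \<bullet> e i\<bar>))) \<partial>subspace_measure S)"
  proof (rule nn_integral_mono)
    fix x
    have "(\<Sum>i<dim S. \<bar>x \<bullet> e i\<bar>) \<le> (\<Sum>i<dim S. norm x)"
      by (intro sum_mono) (metis Cauchy_Schwarz_ineq2 e(1) lessThan_iff mult.right_neutral)
    also have "\<dots> \<le> (dim S + 1) * norm x" by (simp add: algebra_simps)
    finally have "\<delta> * (\<Sum>i<dim S. \<bar>x \<bullet> e i\<bar>) \<le> \<delta> * ((dim S + 1) * norm x)"
      using \<delta> by (intro mult_left_mono) auto
    also have "\<dots> = \<epsilon> * norm x" by (simp add: \<delta>_def field_simps)
    finally show "ennreal (exp (- \<epsilon> * norm x)) \<le> (\<Prod>i<dim S. ennreal (exp (- \<delta> * \<bar>x \<bullet> e i\<bar>)))"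
      by (simp add: prod_ennreal exp_sum[symmetric] sum_negf sum_distrib_left)
  qed
  also have "\<dots> < \<infinity>" unfolding e(2) using fin by (simp add: power_less_top_ennreal)
  finally show ?thesis by (subst integrable_iff_bounded) auto
qed

end

section \<open>Splitting Lebesgue measure along a subspace and its orthogonal complement\<close>

lemma orthogonal_comp_inner: "x \<in> S\<^sup>\<bottom> \<Longrightarrow> y \<in> S \<Longrightarrow> x \<bullet> y = 0"
  by (auto simp: orthogonal_comp_def orthogonal_def inner_commute)

context
  fixes S :: "'a::euclidean_space set"
  assumes S: "subspace S"
begin

interpretation orth: sigma_finite_measure "subspace_measure (S\<^sup>\<bottom>)"
  by (rule sigma_finite_subspace_measure[OF subspace_orthogonal_comp])

interpretation sub: sigma_finite_measure "subspace_measure S"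
  by (rule sigma_finite_subspace_measure[OF S])

interpretation pair: pair_sigma_finite "subspace_measure (S\<^sup>\<bottom>)" "subspace_measure S" ..

lemma dim_orthogonal_comp: "dim (S\<^sup>\<bottom>) + dim S = DIM('a)"
  using dim_subspace_orthogonal_to_vectors[OF S subspace_UNIV]
  by (simp add: orthogonal_comp_def)

lemma orthogonal_decomposition:
  obtains x y where "x \<in> S\<^sup>\<bottom>" "y \<in> S" "s = x + y"
proof -
  have "s \<in> S + S\<^sup>\<bottom>" using subspace_sum_orthogonal_comp[OF S] by simp
  then show ?thesis using that by (metis add.commute set_plus_elim)
qed

text \<open>The image measure \<open>N\<close> is translation invariant, so it is proportional to
  \<open>lborel\<close>, and comparing Gaussian integrals gives the factor. With
  \<open>c = ln T\<close> this factor is the source of the power of the logarithm.\<close>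

lemma emeasure_lborel_subspace_split:
  assumes c: "c > 0" and A[measurable]: "A \<in> sets borel"
  shows "emeasure lborel A = ennreal (c ^ dim S) *
    emeasure (distr (subspace_measure (S\<^sup>\<bottom>) \<Otimes>\<^sub>M subspace_measure S) borel (\<lambda>(x, y). x + c *\<^sub>R y)) A"
proof -
  define N where "N = distr (subspace_measure (S\<^sup>\<bottom>) \<Otimes>\<^sub>M subspace_measure S) borel (\<lambda>(x, y). x + c *\<^sub>R y)"
  have N: "(\<integral>\<^sup>+z. F z \<partial>N) = (\<integral>\<^sup>+x. \<integral>\<^sup>+y. F (x + c *\<^sub>R y) \<partial>subspace_measure S \<partial>subspace_measure (S\<^sup>\<bottom>))"
    if [measurable]: "F \<in> borel_measurable borel" for F
    unfolding N_def by (subst nn_integral_distr) (simp_all add: sub.nn_integral_fst[symmetric] case_prod_beta')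
  have sets: "sets N = sets borel" by (simp add: N_def)
  have inv: "(\<integral>\<^sup>+z. F (z + s) \<partial>N) = (\<integral>\<^sup>+z. F z \<partial>N)" if [measurable]: "F \<in> borel_measurable borel" for F s
  proof -
    obtain u v where uv: "u \<in> S\<^sup>\<bottom>" "v \<in> S" "s = u + v" by (rule orthogonal_decomposition)
    \<comment> \<open>Since \<open>y\<close> enters multiplied by \<open>c\<close>, a shift by
      \<open>v\<close> is a shift of \<open>y\<close> by \<open>v\<close> divided by
      \<open>c\<close>.\<close>
    have v: "(1/c) *\<^sub>R v \<in> S" using uv S by (simp add: subspace_scale)
    have "(\<integral>\<^sup>+z. F (z + s) \<partial>N)
       = (\<integral>\<^sup>+x. \<integral>\<^sup>+y. F ((x + u) + c *\<^sub>R (y + (1/c) *\<^sub>R v)) \<partial>subspace_measure S \<partial>subspace_measure (S\<^sup>\<bottom>))"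
      using c by (subst N) (simp_all add: uv(3) algebra_simps)
    also have "\<dots> = (\<integral>\<^sup>+x. \<integral>\<^sup>+y. F ((x + u) + c *\<^sub>R y) \<partial>subspace_measure S \<partial>subspace_measure (S\<^sup>\<bottom>))"
      by (intro nn_integral_cong nn_integral_subspace_measure_translation[OF S v, of "\<lambda>y. F ((x + u) + c *\<^sub>R y)" for x]) simp
    also have "\<dots> = (\<integral>\<^sup>+x. \<integral>\<^sup>+y. F (x + c *\<^sub>R y) \<partial>subspace_measure S \<partial>subspace_measure (S\<^sup>\<bottom>))"
      by (rule nn_integral_subspace_measure_translation[OF subspace_orthogonal_comp uv(1),
            of "\<lambda>x. \<integral>\<^sup>+y. F (x + c *\<^sub>R y) \<partial>subspace_measure S"]) measurable
    finally show ?thesis by (simp add: N)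
  qed
  define G where "G = (\<integral>\<^sup>+z. ennreal (exp (- (norm z)\<^sup>2)) \<partial>N)"
  have "G = (\<integral>\<^sup>+x. \<integral>\<^sup>+y. ennreal (exp (- (norm (1 *\<^sub>R x))\<^sup>2)) * ennreal (exp (- (norm (c *\<^sub>R y))\<^sup>2))
      \<partial>subspace_measure S \<partial>subspace_measure (S\<^sup>\<bottom>))"
    unfolding G_def
  proof (subst N)
    have "ennreal (exp (- (norm (x + c *\<^sub>R y))\<^sup>2))
        = ennreal (exp (- (norm (1 *\<^sub>R x))\<^sup>2)) * ennreal (exp (- (norm (c *\<^sub>R y))\<^sup>2))"
      if "x \<in> S\<^sup>\<bottom>" "y \<in> S" for x y
    proof -
      \<comment> \<open>Pythagoras turns the Gaussian of the sum into a product of Gaussians in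
        \<open>x\<close> and in \<open>y\<close>.\<close>
      have "orthogonal x (c *\<^sub>R y)"
        using that by (simp add: orthogonal_def orthogonal_comp_inner)
      then have "(norm (x + c *\<^sub>R y))\<^sup>2 = (norm x)\<^sup>2 + (norm (c *\<^sub>R y))\<^sup>2"
        by (rule norm_add_Pythagorean)
      then show ?thesis by (simp add: ennreal_mult[symmetric] exp_add[symmetric])
    qed
    then show "(\<integral>\<^sup>+x. \<integral>\<^sup>+y. ennreal (exp (- (norm (x + c *\<^sub>R y))\<^sup>2)) \<partial>subspace_measure S \<partial>subspace_measure (S\<^sup>\<bottom>))
      = (\<integral>\<^sup>+x. \<integral>\<^sup>+y. ennreal (exp (- (norm (1 *\<^sub>R x))\<^sup>2)) * ennreal (exp (- (norm (c *\<^sub>R y))\<^sup>2))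
      \<partial>subspace_measure S \<partial>subspace_measure (S\<^sup>\<bottom>))"
      using AE_subspace_measure[OF S] AE_subspace_measure[OF subspace_orthogonal_comp, of S]
      by (intro nn_integral_cong_AE) (auto elim!: eventually_mono intro!: nn_integral_cong_AE)
  qed simp
  also have "\<dots> = gauss 1 ^ dim (S\<^sup>\<bottom>) * gauss c ^ dim S"
    by (subst nn_integral_cmult, simp, subst nn_integral_multc, simp)
      (simp only: gaussian_subspace_measure[OF S] gaussian_subspace_measure[OF subspace_orthogonal_comp])
  finally have G: "G = gauss 1 ^ dim (S\<^sup>\<bottom>) * gauss c ^ dim S" .
  \<comment> \<open>Each factor \<open>c\<close> combines with one \<open>gauss c\<close> to
    \<open>gauss 1\<close>, and the two dimensions add up to that of the ambient space.\<close>
  have "ennreal (c ^ dim S) * G = gauss 1 ^ dim (S\<^sup>\<bottom>) * (ennreal c * gauss c) ^ dim S"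
    using c by (simp add: G power_mult_distrib ennreal_power mult_ac)
  also have "\<dots> = gauss 1 ^ DIM('a)"
    by (simp add: gauss_scale[OF c, symmetric] power_add[symmetric] dim_orthogonal_comp)
  finally have cG: "ennreal (c ^ dim S) * G = gauss 1 ^ DIM('a)" .
  have gc: "gauss c < \<infinity>" "gauss c \<noteq> 0"
    using gauss_scale[OF c] gauss_finite gauss_pos c by (auto simp: ennreal_mult_less_top)
  \<comment> \<open>Cancelling \<open>G\<close> from an equation of extended reals requires it to be
    finite and nonzero.\<close>
  have fin: "G < \<infinity>"
    unfolding G using gc gauss_finite by (simp add: ennreal_mult_less_top power_less_top_ennreal)
  have "G \<noteq> 0" unfolding G using gc gauss_pos by (simp add: zero_less_iff_neq_zero)
  have "G * emeasure lborel A = gauss 1 ^ DIM('a) * emeasure N A"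
    unfolding G_def gaussian_lborel[symmetric]
    by (rule translation_invariant_eq_lborel[OF sets _ inv A]) (use fin in \<open>simp_all add: G_def\<close>)
  also have "\<dots> = G * (ennreal (c ^ dim S) * emeasure N A)"
    by (simp add: cG[symmetric] mult_ac)
  finally show ?thesis
    unfolding N_def[symmetric] using fin \<open>G \<noteq> 0\<close> by (auto simp: ennreal_mult_cancel_left)
qed

text \<open>Invariance of \<open>lborel\<close> absorbs the base point \<open>s\<close>. An equality
  of measures transfers integrability, integrals and almost everywhere statements alike.\<close>

lemma lborel_subspace_split:
  assumes c: "c > 0"
  shows "(lborel :: 'a measure) = density (distr (subspace_measure (S\<^sup>\<bottom>) \<Otimes>\<^sub>M subspace_measure S) borel
      (\<lambda>(x, y). s + x + c *\<^sub>R y)) (\<lambda>_. ennreal (c ^ dim S))"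
proof (rule measure_eqI)
  fix A :: "'a set" assume "A \<in> sets lborel"
  then have A[measurable]: "A \<in> sets borel" by simp
  have [measurable]: "(+) s -` A \<in> sets borel"
    using measurable_sets[of "(+) s" borel borel A] by simp
  have "emeasure lborel A = emeasure (distr lborel borel ((+) s)) A"
    by (simp add: lborel_distr_plus)
  also have "\<dots> = emeasure lborel ((+) s -` A)" by (subst emeasure_distr) auto
  also have "\<dots> = ennreal (c ^ dim S) *
      emeasure (distr (subspace_measure (S\<^sup>\<bottom>) \<Otimes>\<^sub>M subspace_measure S) borel (\<lambda>(x, y). x + c *\<^sub>R y)) ((+) s -` A)"
    by (rule emeasure_lborel_subspace_split[OF c]) simp
  also have "\<dots> = ennreal (c ^ dim S) *
      emeasure (distr (subspace_measure (S\<^sup>\<bottom>) \<Otimes>\<^sub>M subspace_measure S) borel (\<lambda>(x, y). s + x + c *\<^sub>R y)) A"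
    by (subst (1 2) emeasure_distr) (auto intro!: arg_cong2[of _ _ _ _ "\<lambda>a b. a * emeasure _ b"] simp: add.assoc)
  finally show "emeasure lborel A = emeasure (density (distr (subspace_measure (S\<^sup>\<bottom>) \<Otimes>\<^sub>M subspace_measure S) borel
      (\<lambda>(x, y). s + x + c *\<^sub>R y)) (\<lambda>_. ennreal (c ^ dim S))) A"
    by (subst emeasure_density) (auto simp: nn_integral_cmult)
qed simp

lemma
  fixes F :: "'a \<Rightarrow> real"
  assumes c: "c > 0" and [measurable]: "F \<in> borel_measurable borel"
  shows integrable_lborel_subspace_split:
      "integrable lborel F \<longleftrightarrow> integrable (subspace_measure (S\<^sup>\<bottom>) \<Otimes>\<^sub>M subspace_measure S) (\<lambda>(x, y). F (s + x + c *\<^sub>R y))"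
    and integral_lborel_subspace_split:
      "integral\<^sup>L lborel F = c ^ dim S * integral\<^sup>L (subspace_measure (S\<^sup>\<bottom>) \<Otimes>\<^sub>M subspace_measure S) (\<lambda>(x, y). F (s + x + c *\<^sub>R y))"
proof -
  have c0: "AE x in M. 0 \<le> c ^ dim S" for M :: "'a measure" using c by simp
  show "integrable lborel F \<longleftrightarrow> integrable (subspace_measure (S\<^sup>\<bottom>) \<Otimes>\<^sub>M subspace_measure S) (\<lambda>(x, y). F (s + x + c *\<^sub>R y))"
    using c by (subst lborel_subspace_split[OF c, of s], subst integrable_density[OF _ _ c0])
      (simp_all add: integrable_distr_eq case_prod_beta')
  show "integral\<^sup>L lborel F = c ^ dim S * integral\<^sup>L (subspace_measure (S\<^sup>\<bottom>) \<Otimes>\<^sub>M subspace_measure S) (\<lambda>(x, y). F (s + x + c *\<^sub>R y))"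
    by (subst lborel_subspace_split[OF c, of s], subst integral_density[OF _ _ c0])
      (simp_all add: integral_distr case_prod_beta')
qed

text \<open>Replace \<open>v\<close> by its projection \<open>v'\<close> to \<open>S\<close>. The
  hypothesis makes the set where \<open>v' \<bullet> a = t\<close> Lebesgue null in the ambient
  space; by Fubini almost every slice parallel to \<open>S\<close> is null, and one slice suffices
  since \<open>v'\<close> vanishes on the complement.\<close>

lemma AE_subspace_measure_hyperplane:
  assumes "(\<exists>y\<in>S. v \<bullet> y \<noteq> 0) \<or> t \<noteq> 0"
  shows "AE y in subspace_measure S. v \<bullet> y \<noteq> t"
proof -
  let ?P = "subspace_measure (S\<^sup>\<bottom>) \<Otimes>\<^sub>M subspace_measure S"
  obtain u v' where v: "u \<in> S\<^sup>\<bottom>" "v' \<in> S" "v = u + v'" by (rule orthogonal_decomposition)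
  have v_eq: "v \<bullet> y = v' \<bullet> (x + y)" if "x \<in> S\<^sup>\<bottom>" "y \<in> S" for x y
    using that v orthogonal_comp_inner[of x S v'] orthogonal_comp_inner[of u S y]
    by (simp add: inner_add_left inner_add_right inner_commute)
  have "v' \<noteq> 0 \<or> t \<noteq> 0"
    using assms v_eq[of 0] by (auto simp: subspace_0 subspace_orthogonal_comp)
  then have "negligible {a. v' \<bullet> a = t}" by (rule negligible_hyperplane)
  moreover have [measurable]: "{a. v' \<bullet> a = t} \<in> sets borel"
    by (intro borel_closed closed_hyperplane)
  ultimately have "{a. v' \<bullet> a = t} \<in> null_sets lborel"
    by (simp add: negligible_iff_null_sets null_sets_def)
  then have "AE a in lborel. v' \<bullet> a \<noteq> t"
    by (auto dest: AE_not_in)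
  then have "AE a in distr ?P borel (\<lambda>(x, y). 0 + x + 1 *\<^sub>R y). v' \<bullet> a \<noteq> t"
    by (subst (asm) lborel_subspace_split[of 1 0], simp, subst (asm) AE_density) simp_all
  then have "AE z in ?P. v' \<bullet> (fst z + snd z) \<noteq> t"
    by (subst (asm) AE_distr_iff) (auto simp: case_prod_beta')
  then have "AE x in subspace_measure (S\<^sup>\<bottom>). AE y in subspace_measure S. v' \<bullet> (x + y) \<noteq> t"
    using pair.AE_pair[of "\<lambda>z. v' \<bullet> (fst z + snd z) \<noteq> t"] by simp
  then have "AE x in subspace_measure (S\<^sup>\<bottom>). x \<in> S\<^sup>\<bottom> \<and> (AE y in subspace_measure S. v' \<bullet> (x + y) \<noteq> t)"
    using AE_subspace_measure[OF subspace_orthogonal_comp, of S] by eventually_elim simp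
  \<comment> \<open>A nonzero measure satisfies \<open>False\<close> nowhere near almost everywhere,
    so some \<open>x\<close> with a null slice exists.\<close>
  moreover have "\<not> (AE x in subspace_measure (S\<^sup>\<bottom>). False)"
    using subspace_measure_UNIV_nonzero[OF subspace_orthogonal_comp, of S]
    by (subst AE_iff_measurable[of UNIV]) auto
  ultimately obtain x where x: "x \<in> S\<^sup>\<bottom>" "AE y in subspace_measure S. v' \<bullet> (x + y) \<noteq> t"
    by (metis (no_types, lifting) eventually_mono)
  show ?thesis
    using x(2) AE_subspace_measure[OF S] by eventually_elim (use v_eq[OF x(1)] in simp)
qed

end

section \<open>Product integrals and coefficient functionals\<close>

lemma (in pair_sigma_finite)
  fixes g :: "'a \<Rightarrow> real" and h :: "'b \<Rightarrow> real"
  assumes g: "integrable M1 g" and h: "integrable M2 h"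
  shows integrable_pair_mult: "integrable (M1 \<Otimes>\<^sub>M M2) (\<lambda>(x, y). g x * h y)"
    and integral_pair_mult: "(\<integral>(x, y). g x * h y \<partial>(M1 \<Otimes>\<^sub>M M2)) = integral\<^sup>L M1 g * integral\<^sup>L M2 h"
proof -
  have [measurable]: "g \<in> borel_measurable M1" "h \<in> borel_measurable M2" using g h by auto
  show i: "integrable (M1 \<Otimes>\<^sub>M M2) (\<lambda>(x, y). g x * h y)"
    by (rule Fubini_integrable) (use g h in \<open>auto simp: abs_mult\<close>)
  show "(\<integral>(x, y). g x * h y \<partial>(M1 \<Otimes>\<^sub>M M2)) = integral\<^sup>L M1 g * integral\<^sup>L M2 h"
    by (subst integral_fst[OF i, symmetric]) simp
qed

text \<open>The functional dual to \<open>w j\<close> extends linearly to the whole space and is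
  bounded there. Since \<open>K\<close> does not depend on \<open>s\<close>, it serves the full sum
  in \<open>phi_map\<close> and the partial sum in \<open>psi_map\<close>.\<close>

lemma bounded_coefficient:
  fixes w :: "'i \<Rightarrow> 'w::euclidean_space"
  assumes ind: "independent (w ` J)" and inj: "inj_on w J" and j: "j \<in> J"
  obtains K where "K > 0" "\<And>s c. finite s \<Longrightarrow> s \<subseteq> J \<Longrightarrow> j \<in> s \<Longrightarrow> \<bar>c j\<bar> \<le> K * norm (\<Sum>i\<in>s. c i *\<^sub>R w i)"
proof -
  obtain g :: "'w \<Rightarrow> real" where g: "linear g" "\<And>x. x \<in> w ` J \<Longrightarrow> g x = (if x = w j then 1 else 0)"
    using linear_independent_extend[OF ind, of "\<lambda>x. if x = w j then 1 else 0"] by auto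
  then obtain K where K: "K > 0" "\<And>x. norm (g x) \<le> K * norm x"
    using linear_bounded_pos by blast
  have "\<bar>c j\<bar> \<le> K * norm (\<Sum>i\<in>s. c i *\<^sub>R w i)" if s: "finite s" "s \<subseteq> J" "j \<in> s" for s c
  proof -
    have "g (\<Sum>i\<in>s. c i *\<^sub>R w i) = (\<Sum>i\<in>s. c i * g (w i))"
      using g(1) by (simp add: linear_sum linear_scale)
    also have "\<dots> = (\<Sum>i\<in>s. if i = j then c i else 0)"
      using s inj j by (intro sum.cong) (auto simp: g(2) inj_on_def subset_iff)
    also have "\<dots> = c j" using s by simp
    finally show ?thesis using K(2)[of "\<Sum>i\<in>s. c i *\<^sub>R w i"] by simp
  qed
  then show ?thesis using that K(1) by blast
qed

section \<open>Exponential sums over a cone\<close>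

locale exponential_sum =
  fixes \<Delta> :: "'a::euclidean_space set"
    and k :: nat and lam :: "nat \<Rightarrow> 'a" and w :: "nat \<Rightarrow> 'w::euclidean_space"
    and ch :: 'a and f :: "'w \<Rightarrow> real"
  assumes k: "k \<ge> 1"
    and w_indep: "independent (w ` {1..k})" and w_inj: "inj_on w {1..k}"
    and Delta_basis: "independent \<Delta>" "span \<Delta> = UNIV"
    and lam1_pos: "\<forall>\<alpha>\<in>\<Delta>. representation \<Delta> (lam 1) \<alpha> > 0"
    and lam_dom: "\<forall>i\<in>{1..k}. \<forall>\<alpha>\<in>\<Delta>. representation \<Delta> (lam 1 - lam i) \<alpha> \<ge> 0"
    and f_cont: "continuous_on UNIV f" and f_supp: "compact (closure {x. f x \<noteq> 0})"
    and a_pos: "a_chi \<Delta> (lam 1) ch > 0"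
begin

text \<open>Keeps the index in \<open>lam 1\<close> from being rewritten to
  \<open>Suc 0\<close>.\<close>

declare One_nat_def [simp del]

abbreviation A where "A \<equiv> a_chi \<Delta> (lam 1) ch"
abbreviation I where "I \<equiv> I_chi \<Delta> (lam 1) ch"
abbreviation D where "D \<equiv> d0_chi \<Delta> (lam 1) ch"
abbreviation m where "m \<equiv> representation \<Delta> (lam 1)"
abbreviation v where "v \<equiv> representation \<Delta> ch"

section \<open>Coefficients in the basis, and the subspace \<open>D\<close>\<close>

lemma finite_Delta: "finite \<Delta>"
  using Delta_basis(1) by (rule independent_imp_finite)

lemma Delta_nonempty: "\<Delta> \<noteq> {}"
  using Delta_basis(2) by (metis UNIV_not_singleton span_empty)

lemma I_subset: "I \<subseteq> \<Delta>" by (auto simp: I_chi_def)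

lemma finite_I: "finite I" using I_subset finite_Delta by (rule finite_subset)

lemma inner_expand: "u \<bullet> a = (\<Sum>\<alpha>\<in>\<Delta>. representation \<Delta> u \<alpha> * (\<alpha> \<bullet> a))"
proof -
  have "u = (\<Sum>\<alpha>\<in>\<Delta>. representation \<Delta> u \<alpha> *\<^sub>R \<alpha>)"
    using sum_representation_eq[OF Delta_basis(1) _ finite_Delta subset_refl, of u] Delta_basis(2) by simp
  then have "u \<bullet> a = (\<Sum>\<alpha>\<in>\<Delta>. representation \<Delta> u \<alpha> *\<^sub>R \<alpha>) \<bullet> a" by simp
  then show ?thesis by (simp add: inner_sum_left)
qed

lemma m_pos: "\<alpha> \<in> \<Delta> \<Longrightarrow> m \<alpha> > 0" using lam1_pos by blast

lemma v_less: "\<alpha> \<in> I \<Longrightarrow> v \<alpha> < A * m \<alpha>"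
  using m_pos by (auto simp: I_chi_def divide_less_eq)

lemma v_eq: "\<alpha> \<in> \<Delta> - I \<Longrightarrow> v \<alpha> = A * m \<alpha>"
proof -
  assume a: "\<alpha> \<in> \<Delta> - I"
  then have "v \<alpha> / m \<alpha> \<le> A"
    unfolding a_chi_def using finite_Delta by (intro Max_ge) auto
  then have "v \<alpha> / m \<alpha> = A" using a by (auto simp: I_chi_def)
  then show ?thesis using m_pos[of \<alpha>] a by (auto simp: field_simps)
qed

lemma ex_maximal: "\<exists>\<alpha>. \<alpha> \<in> \<Delta> - I"
proof -
  have "A \<in> (\<lambda>\<alpha>. v \<alpha> / m \<alpha>) ` \<Delta>"
    unfolding a_chi_def using finite_Delta Delta_nonempty by (intro Max_in) auto
  then show ?thesis by (auto simp: I_chi_def)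
qed

text \<open>The coordinate functional at \<open>\<alpha>\<close> on the space spanned by
  \<open>\<Delta>\<close> is represented by a vector through its adjoint.\<close>

lemma dual_vector:
  assumes "\<alpha> \<in> \<Delta>"
  obtains z where "\<alpha> \<bullet> z = 1" "\<And>\<beta>. \<beta> \<in> \<Delta> \<Longrightarrow> \<beta> \<noteq> \<alpha> \<Longrightarrow> \<beta> \<bullet> z = 0"
proof -
  obtain g :: "'a \<Rightarrow> real" where g: "linear g" "\<And>x. x \<in> \<Delta> \<Longrightarrow> g x = (if x = \<alpha> then 1 else 0)"
    using linear_independent_extend[OF Delta_basis(1), of "\<lambda>x. if x = \<alpha> then 1 else 0"] by auto
  have "x \<bullet> adjoint g 1 = g x" for x
    using adjoint_works[OF g(1), of x 1] by simp
  then show ?thesis using that[of "adjoint g 1"] g(2) assms by simp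
qed

text \<open>The coefficients of \<open>A \<lambda>_1 - \<chi>\<close> vanish off \<open>I\<close> by
  \<open>v_eq\<close> and are positive on \<open>I\<close> by \<open>v_less\<close>. Thus
  \<open>\<chi>\<close> is \<open>A \<lambda>_1\<close> on the kernel of \<open>I\<close>, and falls
  below it when the elements of \<open>I\<close> are nonnegative.\<close>

lemma ch_expand: "ch \<bullet> a = A * (lam 1 \<bullet> a) - (\<Sum>\<alpha>\<in>I. (A * m \<alpha> - v \<alpha>) * (\<alpha> \<bullet> a))"
proof -
  have "A * (lam 1 \<bullet> a) - ch \<bullet> a = (\<Sum>\<alpha>\<in>\<Delta>. (A * m \<alpha> - v \<alpha>) * (\<alpha> \<bullet> a))"
    unfolding inner_expand[of "lam 1"] inner_expand[of ch]
    by (simp add: sum_distrib_left sum_subtractf algebra_simps)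
  also have "\<dots> = (\<Sum>\<alpha>\<in>I. (A * m \<alpha> - v \<alpha>) * (\<alpha> \<bullet> a))"
    using finite_Delta I_subset v_eq by (intro sum.mono_neutral_right) auto
  finally show ?thesis by simp
qed

text \<open>On the kernel of \<open>I\<close> the functional \<open>\<chi>\<close> is
  \<open>A\<close> times \<open>\<lambda>_1\<close> by \<open>ch_expand\<close>, and
  \<open>A\<close> is nonzero by \<open>a_pos\<close>, so the two have the same kernel
  there.\<close>

lemma D_iff: "y \<in> D \<longleftrightarrow> (\<forall>\<alpha>\<in>I. \<alpha> \<bullet> y = 0) \<and> lam 1 \<bullet> y = 0"
  using a_pos ch_expand[of y] by (auto simp: d0_chi_def ker_set_def)

lemma subspace_D: "subspace D"
  by (auto simp: subspace_def D_iff inner_add_right)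

text \<open>A dual vector at a basis element outside \<open>I\<close> is orthogonal to
  \<open>span I\<close>, while \<open>\<lambda>_1\<close> takes the positive value
  \<open>m \<alpha>\<close> on it.\<close>

lemma lam1_notin_span: "lam 1 \<notin> span I"
proof
  assume s: "lam 1 \<in> span I"
  obtain \<alpha> where a: "\<alpha> \<in> \<Delta> - I" using ex_maximal by blast
  then obtain z where z: "\<alpha> \<bullet> z = 1" "\<And>\<beta>. \<beta> \<in> \<Delta> \<Longrightarrow> \<beta> \<noteq> \<alpha> \<Longrightarrow> \<beta> \<bullet> z = 0"
    using dual_vector[of \<alpha>] by blast
  have "orthogonal z (lam 1)"
    using s by (rule orthogonal_to_span)
      (use z(2) a I_subset in \<open>auto simp: orthogonal_def inner_commute\<close>)
  moreover have "lam 1 \<bullet> z = m \<alpha>"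
    unfolding inner_expand[of "lam 1"] using a z finite_Delta
    by (subst sum.remove[of _ \<alpha>]) (auto intro!: sum.neutral)
  ultimately show False using m_pos[of \<alpha>] a by (simp add: orthogonal_def inner_commute)
qed

text \<open>\<open>D\<close> is the orthogonal complement of the span of the independent set
  \<open>insert (lam 1) I\<close>, so its dimension is that of the space minus
  \<open>card I + 1\<close>. The subtraction is real, as in the exponent of
  \<open>ln T\<close>.\<close>

lemma dim_D: "real (dim D) = real (b_chi \<Delta> (lam 1) ch) - 1"
proof -
  have ind: "independent (insert (lam 1) I)"
    using lam1_notin_span independent_mono[OF Delta_basis(1) I_subset] by (rule independent_insertI)
  have D: "{y \<in> UNIV. \<forall>x\<in>span (insert (lam 1) I). orthogonal x y} = D"
  proof (intro set_eqI iffI)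
    fix y assume "y \<in> {y \<in> UNIV. \<forall>x\<in>span (insert (lam 1) I). orthogonal x y}"
    then show "y \<in> D" by (auto simp: D_iff orthogonal_def span_base)
  next
    fix y assume y: "y \<in> D"
    have "orthogonal y x" if "x \<in> span (insert (lam 1) I)" for x
      using that by (rule orthogonal_to_span) (use y in \<open>auto simp: D_iff orthogonal_def inner_commute\<close>)
    then show "y \<in> {y \<in> UNIV. \<forall>x\<in>span (insert (lam 1) I). orthogonal x y}"
      by (auto simp: orthogonal_commute)
  qed
  have "dim D + dim (span (insert (lam 1) I)) = DIM('a)"
    using dim_subspace_orthogonal_to_vectors[of "span (insert (lam 1) I)" UNIV] unfolding D by simp
  moreover have "dim (span (insert (lam 1) I)) = card I + 1"
    using lam1_notin_span span_base finite_I dim_span_eq_card_independent[OF ind] by (metis card_insert_disjoint Suc_eq_plus1)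
  moreover have "DIM('a) = card \<Delta>"
    using dim_span_eq_card_independent[OF Delta_basis(1)] Delta_basis(2) by simp
  moreover have "card (\<Delta> - I) = card \<Delta> - card I" "card I \<le> card \<Delta>"
    using I_subset finite_I finite_Delta by (auto simp: card_Diff_subset card_mono)
  ultimately show ?thesis unfolding b_chi_def by linarith
qed

section \<open>The affine slice and the constant \<open>kappa_chi\<close>\<close>

definition slice where "slice = ker_set I \<inter> {a. lam 1 \<bullet> a = 1}"
text \<open>The same choice as in \<open>affine_measure\<close>, so that \<open>kappa_chi\<close>
  becomes an integral over \<open>p + D\<close> for this very \<open>p\<close>.\<close>

definition p where "p = (SOME p. p \<in> slice)"

text \<open>A dual vector at an element \<open>\<alpha>\<close> outside \<open>I\<close> annihilates
  \<open>I\<close>; dividing it by \<open>m \<alpha>\<close> normalises \<open>\<lambda>_1\<close>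
  to 1.\<close>

lemma p_slice: "p \<in> slice"
proof -
  obtain \<alpha> where a: "\<alpha> \<in> \<Delta> - I" using ex_maximal by blast
  then obtain z where z: "\<alpha> \<bullet> z = 1" "\<And>\<beta>. \<beta> \<in> \<Delta> \<Longrightarrow> \<beta> \<noteq> \<alpha> \<Longrightarrow> \<beta> \<bullet> z = 0"
    using dual_vector[of \<alpha>] by blast
  have "lam 1 \<bullet> z = m \<alpha>"
    unfolding inner_expand[of "lam 1"] using a z finite_Delta
    by (subst sum.remove[of _ \<alpha>]) (auto intro!: sum.neutral)
  then have "(1 / m \<alpha>) *\<^sub>R z \<in> slice"
    using z(2) a I_subset m_pos[of \<alpha>] by (auto simp: slice_def ker_set_def)
  then show ?thesis unfolding p_def by (rule someI)
qed

lemma I_p: "\<alpha> \<in> I \<Longrightarrow> \<alpha> \<bullet> p = 0" and lam1_p: "lam 1 \<bullet> p = 1"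
  using p_slice by (auto simp: slice_def ker_set_def)

lemma ch_p: "ch \<bullet> p = A" unfolding ch_expand by (simp add: I_p lam1_p)

lemma I_D: "\<alpha> \<in> I \<Longrightarrow> y \<in> D \<Longrightarrow> \<alpha> \<bullet> y = 0"
  and lam1_D: "y \<in> D \<Longrightarrow> lam 1 \<bullet> y = 0"
  by (auto simp: D_iff)

lemma ch_D: "y \<in> D \<Longrightarrow> ch \<bullet> y = 0"
  by (auto simp: d0_chi_def)

lemma slice_iff: "y + p \<in> slice \<longleftrightarrow> y \<in> D"
  by (auto simp: slice_def ker_set_def D_iff inner_add_right I_p lam1_p)

text \<open>Subtracting a multiple of \<open>p\<close> from a dual vector at \<open>\<alpha>\<close>
  gives an element of \<open>D\<close>; if \<open>\<alpha>\<close> vanished on \<open>D\<close> and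
  at \<open>p\<close>, it would vanish on the dual vector. The disjunction is the hypothesis of
  \<open>AE_subspace_measure_hyperplane\<close> with
  \<open>t = - (\<alpha> \<bullet> p)\<close>.\<close>

lemma maximal_nonzero:
  assumes a: "\<alpha> \<in> \<Delta> - I"
  shows "(\<exists>y\<in>D. \<alpha> \<bullet> y \<noteq> 0) \<or> - (\<alpha> \<bullet> p) \<noteq> 0"
proof (rule ccontr)
  assume n: "\<not> ?thesis"
  obtain z where z: "\<alpha> \<bullet> z = 1" "\<And>\<beta>. \<beta> \<in> \<Delta> \<Longrightarrow> \<beta> \<noteq> \<alpha> \<Longrightarrow> \<beta> \<bullet> z = 0"
    using dual_vector[of \<alpha>] a by blast
  have "z - (lam 1 \<bullet> z) *\<^sub>R p \<in> D"
    using a z(2) I_subset by (auto simp: D_iff inner_diff_right I_p lam1_p)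
  then have "\<alpha> \<bullet> (z - (lam 1 \<bullet> z) *\<^sub>R p) = 0" using n by blast
  then show False using z(1) n by (simp add: inner_diff_right)
qed

lemma pos_chamber_sets[measurable]: "pos_chamber \<Delta> \<in> sets borel"
proof -
  have "pos_chamber \<Delta> = (\<Inter>\<alpha>\<in>\<Delta>. {a. 0 \<le> \<alpha> \<bullet> a})" by (auto simp: pos_chamber_def)
  then show ?thesis by (auto intro!: borel_closed closed_INT simp: closed_halfspace_ge)
qed

lemma dplus_sets[measurable]: "dplus \<Delta> (lam 1) ch \<in> sets borel"
proof -
  have "dplus \<Delta> (lam 1) ch = D\<^sup>\<bottom> \<inter> (\<Inter>\<alpha>\<in>I. {a. 0 \<le> \<alpha> \<bullet> a})" by (auto simp: dplus_def)
  then show ?thesis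
    by (auto intro!: borel_closed closed_Int closed_INT closed_subspace[OF subspace_orthogonal_comp] simp: closed_halfspace_ge)
qed

lemma phi_measurable[measurable]: "phi_map k lam w \<in> borel_measurable borel"
  unfolding phi_map_def by measurable

lemma psi_measurable[measurable]: "psi_map \<Delta> k lam w ch \<in> borel_measurable borel"
  unfolding psi_map_def by measurable

lemma f_measurable[measurable]: "f \<in> borel_measurable borel"
  using f_cont by (rule borel_measurable_continuous_onI)

lemma kappa_eq: "kappa_chi \<Delta> (lam 1) ch = (\<integral>y. indicator (pos_chamber \<Delta>) (p + y) \<partial>subspace_measure D)"
proof -
  have D: "(\<lambda>x. x - p) ` slice = D"
    using slice_iff by (force simp: image_iff)
  have cl: "closed slice"
  proof -
    have "slice = (\<Inter>\<alpha>\<in>I. {a. \<alpha> \<bullet> a = 0}) \<inter> {a. lam 1 \<bullet> a = 1}"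
      by (auto simp: slice_def ker_set_def)
    then show ?thesis by (auto intro!: closed_Int closed_INT closed_hyperplane)
  qed
  have [measurable]: "slice \<in> sets borel" using cl by (rule borel_closed)
  have "kappa_chi \<Delta> (lam 1) ch = measure (distr (subspace_measure D) borel (\<lambda>y. y + p)) (pos_chamber \<Delta> \<inter> slice)"
    unfolding kappa_chi_def Let_def affine_measure_def slice_def[symmetric] p_def[symmetric] D ..
  also have "\<dots> = (\<integral>y. indicator (pos_chamber \<Delta> \<inter> slice) y \<partial>distr (subspace_measure D) borel (\<lambda>y. y + p))"
    by simp
  also have "\<dots> = (\<integral>y. indicator (pos_chamber \<Delta> \<inter> slice) (y + p) \<partial>subspace_measure D)"
    by (subst integral_distr) simp_all
  also have "\<dots> = (\<integral>y. indicator (pos_chamber \<Delta>) (p + y) \<partial>subspace_measure D)"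
    by (rule integral_cong_AE, simp, simp, use AE_subspace_measure[OF subspace_D] in eventually_elim)
      (auto simp: slice_iff indicator_def add.commute)
  finally show ?thesis .
qed

abbreviation M0 where "M0 \<equiv> subspace_measure D"
abbreviation M1 where "M1 \<equiv> subspace_measure (D\<^sup>\<bottom>)"

interpretation M0: sigma_finite_measure M0
  by (rule sigma_finite_subspace_measure[OF subspace_D])

interpretation M1: sigma_finite_measure M1
  by (rule sigma_finite_subspace_measure[OF subspace_orthogonal_comp])

interpretation P: pair_sigma_finite M1 M0 ..

section \<open>Bounds for the dominating function\<close>

text \<open>\<open>\<lambda>_1\<close> and \<open>I\<close> separate the points of the orthogonal
  complement of \<open>D\<close>, so their values control the norm. Large values on \<open>I\<close>
  lower \<open>\<chi>\<close> by \<open>ch_expand\<close>, and large values of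
  \<open>\<lambda>_1\<close> can only be negative, which lowers it as well because \<open>A\<close>
  is positive.\<close>

lemma ch_bound:
  assumes c: "c \<ge> 0"
  obtains \<epsilon> C where "\<epsilon> > 0" "\<And>x. x \<in> D\<^sup>\<bottom> \<Longrightarrow> (\<And>\<alpha>. \<alpha> \<in> I \<Longrightarrow> \<alpha> \<bullet> x \<ge> 0) \<Longrightarrow> lam 1 \<bullet> x \<le> c
    \<Longrightarrow> ch \<bullet> x \<le> C - \<epsilon> * norm x"
proof -
  have zero: "x = 0" if "x \<in> D\<^sup>\<bottom>" "\<And>u. u \<in> insert (lam 1) I \<Longrightarrow> u \<bullet> x = 0" for x
  proof -
    have "x \<in> D" using that(2) by (auto simp: D_iff)
    then have "x \<bullet> x = 0" using orthogonal_comp_inner[OF that(1)] by blast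
    then show ?thesis by simp
  qed
  obtain e where e: "e > 0" "\<And>x. x \<in> D\<^sup>\<bottom> \<Longrightarrow> e * norm x \<le> (\<Sum>u\<in>insert (lam 1) I. \<bar>u \<bullet> x\<bar>)"
    using isometric_functionals[OF subspace_orthogonal_comp _ zero] finite_I by (metis finite_insert)
  \<comment> \<open>The smallest rate of decay; inserting \<open>A\<close> accounts for
    \<open>\<lambda>_1\<close> and keeps the set nonempty when \<open>I\<close> is empty.\<close>
  define \<mu> where "\<mu> = Min (insert A ((\<lambda>\<alpha>. A * m \<alpha> - v \<alpha>) ` I))"
  have \<mu>: "\<mu> > 0" "\<mu> \<le> A" "\<And>\<alpha>. \<alpha> \<in> I \<Longrightarrow> \<mu> \<le> A * m \<alpha> - v \<alpha>"
    unfolding \<mu>_def using finite_I a_pos v_less by auto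
  have "ch \<bullet> x \<le> 2 * A * c - \<mu> * e * norm x"
    if x: "x \<in> D\<^sup>\<bottom>" "\<And>\<alpha>. \<alpha> \<in> I \<Longrightarrow> \<alpha> \<bullet> x \<ge> 0" "lam 1 \<bullet> x \<le> c" for x
  proof -
    have "(\<Sum>\<alpha>\<in>I. \<mu> * \<bar>\<alpha> \<bullet> x\<bar>) \<le> (\<Sum>\<alpha>\<in>I. (A * m \<alpha> - v \<alpha>) * (\<alpha> \<bullet> x))"
      using \<mu>(3) x(2) by (intro sum_mono) (simp add: mult_right_mono)
    then have s: "\<mu> * (\<Sum>\<alpha>\<in>I. \<bar>\<alpha> \<bullet> x\<bar>) \<le> (\<Sum>\<alpha>\<in>I. (A * m \<alpha> - v \<alpha>) * (\<alpha> \<bullet> x))"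
      by (simp add: sum_distrib_left)
    \<comment> \<open>Turns the upper bound on \<open>\<lambda>_1\<close> into decay in its absolute
      value; for a positive value this takes the bound twice, for a negative one it uses
      \<open>c \<ge> 0\<close>.\<close>
    have "lam 1 \<bullet> x \<le> 2 * c - \<bar>lam 1 \<bullet> x\<bar>" using x(3) c by linarith
    then have "A * (lam 1 \<bullet> x) \<le> A * (2 * c - \<bar>lam 1 \<bullet> x\<bar>)"
      using a_pos by (intro mult_left_mono) auto
    moreover have "\<mu> * \<bar>lam 1 \<bullet> x\<bar> \<le> A * \<bar>lam 1 \<bullet> x\<bar>" using \<mu>(2) by (intro mult_right_mono) auto
    ultimately have l: "A * (lam 1 \<bullet> x) \<le> 2 * A * c - \<mu> * \<bar>lam 1 \<bullet> x\<bar>" by (simp add: algebra_simps)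
    have "\<mu> * (e * norm x) \<le> \<mu> * (\<Sum>u\<in>insert (lam 1) I. \<bar>u \<bullet> x\<bar>)"
      using e(2)[OF x(1)] \<mu>(1) by (intro mult_left_mono) auto
    also have "\<dots> = \<mu> * \<bar>lam 1 \<bullet> x\<bar> + \<mu> * (\<Sum>\<alpha>\<in>I. \<bar>\<alpha> \<bullet> x\<bar>)"
      using finite_I lam1_notin_span span_base by (subst sum.insert) (auto simp: algebra_simps)
    finally show ?thesis using s l ch_expand[of x] by linarith
  qed
  then show ?thesis using that[of "\<mu> * e" "2 * A * c"] \<mu>(1) e(1) by simp
qed

text \<open>The chamber condition bounds every \<open>\<alpha> \<bullet> (p + y)\<close> below in
  terms of \<open>norm x\<close>. Their sum with the positive weights \<open>m\<close> is
  \<open>\<lambda>_1 (p + y) = 1\<close>, so each is bounded above too. The constant must not depend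
  on \<open>L\<close>, since it enters the dominating function.\<close>

lemma transverse_bound:
  obtains C where "C > 0" "\<And>L x y. L \<ge> 1 \<Longrightarrow> y \<in> D \<Longrightarrow> L *\<^sub>R p + x + L *\<^sub>R y \<in> pos_chamber \<Delta>
    \<Longrightarrow> norm y \<le> C * (1 + norm x)"
proof -
  have "x = 0" if "\<And>u. u \<in> \<Delta> \<Longrightarrow> u \<bullet> x = 0" for x
    using that inner_expand[of x x] by simp
  then obtain e where e: "e > 0" "\<And>x. e * norm x \<le> (\<Sum>u\<in>\<Delta>. \<bar>u \<bullet> x\<bar>)"
    using isometric_functionals[OF subspace_UNIV finite_Delta] by (metis UNIV_I)
  define B where "B = (\<Sum>\<beta>\<in>\<Delta>. m \<beta> * norm \<beta>)"
  have B: "B \<ge> 0" unfolding B_def using m_pos by (intro sum_nonneg) (auto simp: less_imp_le)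
  define Q where "Q = (\<Sum>\<alpha>\<in>\<Delta>. 1 / m \<alpha>)"
  have Q: "Q \<ge> 0" unfolding Q_def using m_pos by (intro sum_nonneg) (auto simp: less_imp_le)
  have bd: "norm y \<le> (Q * (1 + B) / e + norm p + 1) * (1 + norm x)"
    if L: "L \<ge> 1" and y: "y \<in> D" and pos: "L *\<^sub>R p + x + L *\<^sub>R y \<in> pos_chamber \<Delta>" for L x y
  proof -
    have ge: "- (norm \<alpha> * norm x) \<le> \<alpha> \<bullet> (p + y)" if a: "\<alpha> \<in> \<Delta>" for \<alpha>
    proof -
      have "0 \<le> \<alpha> \<bullet> (L *\<^sub>R p + x + L *\<^sub>R y)" using pos a by (auto simp: pos_chamber_def)
      then have "- (\<alpha> \<bullet> x) \<le> L * (\<alpha> \<bullet> (p + y))" by (simp add: inner_add_right algebra_simps)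
      moreover have "\<alpha> \<bullet> x \<le> norm \<alpha> * norm x" by (rule norm_cauchy_schwarz)
      ultimately have l: "- (norm \<alpha> * norm x) \<le> L * (\<alpha> \<bullet> (p + y))" by linarith
      \<comment> \<open>A negative value only becomes smaller when multiplied by
        \<open>L \<ge> 1\<close>, so the bound for the multiple passes to the value itself.\<close>
      show ?thesis
      proof (cases "\<alpha> \<bullet> (p + y) \<ge> 0")
        case True
        then show ?thesis by (meson mult_nonneg_nonneg neg_le_0_iff_le norm_ge_zero order_trans)
      next
        case False
        then have "L * (\<alpha> \<bullet> (p + y)) \<le> 1 * (\<alpha> \<bullet> (p + y))" using L by (intro mult_right_mono_neg) auto
        then show ?thesis using l by simp
      qed
    qed
    have tot: "(\<Sum>\<alpha>\<in>\<Delta>. m \<alpha> * (\<alpha> \<bullet> (p + y))) = 1"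
      using inner_expand[of "lam 1" "p + y"] lam1_p lam1_D[OF y] by (simp add: inner_add_right)
    have mb: "m \<alpha> * \<bar>\<alpha> \<bullet> (p + y)\<bar> \<le> 1 + B * norm x" if a: "\<alpha> \<in> \<Delta>" for \<alpha>
    proof -
      have tm: "- (m \<beta> * norm \<beta> * norm x) \<le> m \<beta> * (\<beta> \<bullet> (p + y))" if "\<beta> \<in> \<Delta>" for \<beta>
        using mult_left_mono[OF ge[OF that], of "m \<beta>"] m_pos[OF that] by simp
      have Bx: "B * norm x = m \<alpha> * norm \<alpha> * norm x + (\<Sum>\<beta>\<in>\<Delta> - {\<alpha>}. m \<beta> * norm \<beta> * norm x)"
        unfolding B_def sum_distrib_right using a finite_Delta by (rule sum.remove[rotated])
      have nn: "0 \<le> (\<Sum>\<beta>\<in>\<Delta> - {\<alpha>}. m \<beta> * norm \<beta> * norm x)" "0 \<le> m \<alpha> * norm \<alpha> * norm x"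
        using m_pos a by (auto intro!: sum_nonneg simp: less_imp_le)
      have "- (\<Sum>\<beta>\<in>\<Delta> - {\<alpha>}. m \<beta> * norm \<beta> * norm x) \<le> (\<Sum>\<beta>\<in>\<Delta> - {\<alpha>}. m \<beta> * (\<beta> \<bullet> (p + y)))"
        unfolding sum_negf[symmetric] using tm by (intro sum_mono) auto
      also have "\<dots> = 1 - m \<alpha> * (\<alpha> \<bullet> (p + y))"
        using tot sum.remove[OF finite_Delta a, of "\<lambda>\<beta>. m \<beta> * (\<beta> \<bullet> (p + y))"] by simp
      finally have "m \<alpha> * (\<alpha> \<bullet> (p + y)) \<le> 1 + B * norm x" using Bx nn by linarith
      moreover have "- (m \<alpha> * (\<alpha> \<bullet> (p + y))) \<le> 1 + B * norm x" using tm[OF a] Bx nn by linarith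
      ultimately have "\<bar>m \<alpha> * (\<alpha> \<bullet> (p + y))\<bar> \<le> 1 + B * norm x" by linarith
      then show ?thesis using m_pos[OF a] by (simp add: abs_mult)
    qed
    have "e * norm (p + y) \<le> (\<Sum>\<alpha>\<in>\<Delta>. \<bar>\<alpha> \<bullet> (p + y)\<bar>)" by (rule e(2))
    also have "\<dots> \<le> (\<Sum>\<alpha>\<in>\<Delta>. (1 / m \<alpha>) * (1 + B * norm x))"
      using mb m_pos by (intro sum_mono) (simp add: field_simps)
    also have "\<dots> = Q * (1 + B * norm x)" by (simp add: Q_def sum_distrib_right)
    also have "\<dots> \<le> Q * ((1 + B) * (1 + norm x))"
      using Q B by (intro mult_left_mono) (simp_all add: algebra_simps)
    finally have n: "norm (p + y) \<le> (Q * (1 + B) / e) * (1 + norm x)"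
      using e(1) by (simp add: field_simps)
    have "norm y \<le> norm (p + y) + norm p" using norm_triangle_ineq4[of "p + y" p] by simp
    moreover have "norm p \<le> (norm p + 1) * (1 + norm x)" by (simp add: algebra_simps)
    moreover have "(Q * (1 + B) / e + norm p + 1) * (1 + norm x)
        = (Q * (1 + B) / e) * (1 + norm x) + (norm p + 1) * (1 + norm x)"
      by (simp add: distrib_right)
    ultimately show ?thesis using n by linarith
  qed
  have "Q * (1 + B) / e + norm p + 1 > 0"
    using Q B e(1) by (simp add: add_nonneg_pos)
  then show ?thesis using that bd by blast
qed

lemma f_bounds:
  obtains F R where "F > 0" "R > 0" "\<And>z. \<bar>f z\<bar> \<le> F" "\<And>z. f z \<noteq> 0 \<Longrightarrow> norm z \<le> R"
proof -
  let ?S = "closure {x. f x \<noteq> 0}"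
  obtain R where R: "R > 0" "\<And>z. z \<in> ?S \<Longrightarrow> norm z \<le> R"
    using compact_imp_bounded[OF f_supp] by (auto simp: bounded_pos)
  have "compact (f ` ?S)"
    by (rule compact_continuous_image[OF continuous_on_subset[OF f_cont subset_UNIV] f_supp])
  then obtain F where F: "F > 0" "\<And>z. z \<in> ?S \<Longrightarrow> \<bar>f z\<bar> \<le> F"
    using compact_imp_bounded[of "f ` ?S"] by (auto simp: bounded_pos)
  have in_S: "z \<in> ?S" if "f z \<noteq> 0" for z using that by (intro subsetD[OF closure_subset]) simp
  have "\<bar>f z\<bar> \<le> F" for z using F in_S[of z] by (cases "f z = 0") auto
  then show ?thesis using that F(1) R in_S by blast
qed

text \<open>The elements of \<open>I\<close> vanish on \<open>p + D\<close>, so only basis elements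
  outside \<open>I\<close> separate \<open>\<lambda>_i\<close> from \<open>\<lambda>_1\<close>
  there.\<close>

lemma lam_p_y:
  assumes y: "y \<in> D"
  shows "lam i \<bullet> (p + y) = 1 - (\<Sum>\<alpha>\<in>\<Delta> - I. representation \<Delta> (lam 1 - lam i) \<alpha> * (\<alpha> \<bullet> (p + y)))"
proof -
  have "lam 1 \<bullet> (p + y) - lam i \<bullet> (p + y) = (\<Sum>\<alpha>\<in>\<Delta>. representation \<Delta> (lam 1 - lam i) \<alpha> * (\<alpha> \<bullet> (p + y)))"
    using inner_expand[of "lam 1 - lam i" "p + y"] by (simp add: inner_diff_left)
  also have "\<dots> = (\<Sum>\<alpha>\<in>\<Delta> - I. representation \<Delta> (lam 1 - lam i) \<alpha> * (\<alpha> \<bullet> (p + y)))"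
    using finite_Delta I_D[OF _ y] I_p by (intro sum.mono_neutral_right) (auto simp: inner_add_right)
  finally show ?thesis using lam1_p lam1_D[OF y] by (simp add: inner_add_right)
qed

section \<open>The rescaled integrand and its pointwise limit\<close>

definition point where "point L x y = L *\<^sub>R p + x + L *\<^sub>R y"

lemma inner_point: "u \<bullet> point L x y = u \<bullet> x + L * (u \<bullet> (p + y))"
  by (simp add: point_def inner_add_right algebra_simps)

text \<open>Here \<open>T\<close> is written as \<open>exp L\<close>, and the factor
  \<open>T powr A\<close>, which the weight contributes along \<open>L *\<^sub>R p\<close>, has been
  divided out.\<close>

definition integrand where
  "integrand L x y = indicator (pos_chamber \<Delta>) (point L x y)
     * f (exp (- L) *\<^sub>R phi_map k lam w (point L x y)) * exp (ch \<bullet> x)"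

definition limit_x where
  "limit_x x = indicator (dplus \<Delta> (lam 1) ch) x * (f (psi_map \<Delta> k lam w ch x) * exp (ch \<bullet> x))"

definition limit_y :: "'a \<Rightarrow> real" where
  "limit_y y = indicator (pos_chamber \<Delta>) (p + y)"

lemma measurable_integrand[measurable]: "(\<lambda>(x, y). integrand L x y) \<in> borel_measurable (M1 \<Otimes>\<^sub>M M0)"
  unfolding integrand_def point_def by measurable

lemma measurable_limits[measurable]: "limit_x \<in> borel_measurable borel" "limit_y \<in> borel_measurable borel"
  unfolding limit_x_def limit_y_def by measurable

lemma scaled_phi_map:
  assumes "y \<in> D"
  shows "exp (- L) *\<^sub>R phi_map k lam w (point L x y) =
    (\<Sum>i=1..k. exp (lam i \<bullet> x - L * (\<Sum>\<alpha>\<in>\<Delta> - I. representation \<Delta> (lam 1 - lam i) \<alpha> * (\<alpha> \<bullet> (p + y)))) *\<^sub>R w i)"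
  unfolding phi_map_def scaleR_sum_right scaleR_scaleR exp_add[symmetric] inner_point lam_p_y[OF assms]
  by (intro sum.cong) (simp_all add: algebra_simps)

lemma supp_subset_iff:
  assumes "i \<in> {1..k}"
  shows "supp_lam \<Delta> (lam 1) (lam i) \<subseteq> I \<longleftrightarrow> (\<forall>\<alpha>\<in>\<Delta> - I. representation \<Delta> (lam 1 - lam i) \<alpha> = 0)"
proof -
  have "representation \<Delta> (lam 1 - lam i) \<alpha> > 0 \<longleftrightarrow> representation \<Delta> (lam 1 - lam i) \<alpha> \<noteq> 0"
    if "\<alpha> \<in> \<Delta>" for \<alpha>
    using bspec[OF bspec[OF lam_dom assms] that] by auto
  then show ?thesis unfolding supp_lam_def by blast
qed

text \<open>The basis elements outside \<open>I\<close> decide. If one is negative at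
  \<open>p + y\<close>, the point eventually leaves the chamber and both sides are 0. If all are
  positive, only the conditions from \<open>I\<close> survive, and these involve \<open>x\<close>
  alone. The hypothesis \<open>nz\<close> excludes the boundary between the cases.\<close>

lemma integrand_tendsto:
  assumes x: "x \<in> D\<^sup>\<bottom>" and y: "y \<in> D" and nz: "\<And>\<alpha>. \<alpha> \<in> \<Delta> - I \<Longrightarrow> \<alpha> \<bullet> (p + y) \<noteq> 0"
  shows "((\<lambda>L. integrand L x y) \<longlongrightarrow> limit_x x * limit_y y) at_top"
proof -
  have I0: "\<alpha> \<in> I \<Longrightarrow> \<alpha> \<bullet> (p + y) = 0" for \<alpha>
    using I_p I_D y by (simp add: inner_add_right)
  have lin: "filterlim (\<lambda>L. a + L * b) at_top at_top" if "b > 0" for a b :: real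
    using that by real_asymp
  have lin': "filterlim (\<lambda>L. a + L * b) at_bot at_top" if "b < 0" for a b :: real
    using that by real_asymp
  show ?thesis
  proof (cases "\<forall>\<alpha>\<in>\<Delta> - I. \<alpha> \<bullet> (p + y) > 0")
    case False
    then obtain \<alpha> where a: "\<alpha> \<in> \<Delta> - I" "\<alpha> \<bullet> (p + y) < 0" using nz by force
    have "\<forall>\<^sub>F L in at_top. \<alpha> \<bullet> x + L * (\<alpha> \<bullet> (p + y)) < 0"
      using lin'[OF a(2)] by (rule filterlim_at_bot_dense[THEN iffD1, rule_format])
    then have "\<forall>\<^sub>F L in at_top. integrand L x y = 0"
      by eventually_elim (use a in \<open>force simp: integrand_def pos_chamber_def inner_point indicator_def\<close>)
    moreover have "limit_y y = 0"
      using a by (force simp: limit_y_def pos_chamber_def indicator_def)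
    ultimately show ?thesis by (simp add: tendsto_eventually)
  next
    case True
    have ly: "limit_y y = 1"
    proof -
      have "\<alpha> \<bullet> (p + y) \<ge> 0" if "\<alpha> \<in> \<Delta>" for \<alpha>
        using True I0[of \<alpha>] that by (cases "\<alpha> \<in> I") (auto simp: less_imp_le)
      then show ?thesis by (simp add: limit_y_def pos_chamber_def)
    qed
    have "\<forall>\<^sub>F L in at_top. \<forall>\<alpha>\<in>\<Delta> - I. \<alpha> \<bullet> x + L * (\<alpha> \<bullet> (p + y)) \<ge> 0"
    proof (rule eventually_ball_finite)
      show "finite (\<Delta> - I)" using finite_Delta by simp
      show "\<forall>\<alpha>\<in>\<Delta> - I. \<forall>\<^sub>F L in at_top. \<alpha> \<bullet> x + L * (\<alpha> \<bullet> (p + y)) \<ge> 0"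
        using lin True by (auto simp: filterlim_at_top)
    qed
    then have ind: "\<forall>\<^sub>F L in at_top. (indicator (pos_chamber \<Delta>) (point L x y) :: real) = indicator (dplus \<Delta> (lam 1) ch) x"
    proof eventually_elim
      case (elim L)
      have "point L x y \<in> pos_chamber \<Delta> \<longleftrightarrow> (\<forall>\<alpha>\<in>I. \<alpha> \<bullet> x + L * (\<alpha> \<bullet> (p + y)) \<ge> 0)"
        unfolding pos_chamber_def inner_point mem_Collect_eq using elim I_subset by blast
      also have "\<dots> \<longleftrightarrow> x \<in> dplus \<Delta> (lam 1) ch"
        using x by (simp add: dplus_def I0)
      finally show ?case by (simp add: indicator_def)
    qed
    have "((\<lambda>L. exp (- L) *\<^sub>R phi_map k lam w (point L x y)) \<longlongrightarrow> psi_map \<Delta> k lam w ch x) at_top"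
    proof -
      let ?s = "{i \<in> {1..k}. supp_lam \<Delta> (lam 1) (lam i) \<subseteq> I}"
      \<comment> \<open>Padding by zeros to all indices lets the convergence be checked term by
        term.\<close>
      have psi: "psi_map \<Delta> k lam w ch x = (\<Sum>i=1..k. (if i \<in> ?s then exp (lam i \<bullet> x) else 0) *\<^sub>R w i)"
        unfolding psi_map_def by (rule sum.mono_neutral_cong_left) auto
      show ?thesis unfolding scaled_phi_map[OF y] psi
      proof (intro tendsto_sum tendsto_scaleR tendsto_const)
        fix i assume i: "i \<in> {1..k}"
        let ?q = "\<Sum>\<alpha>\<in>\<Delta> - I. representation \<Delta> (lam 1 - lam i) \<alpha> * (\<alpha> \<bullet> (p + y))"
        show "((\<lambda>L. exp (lam i \<bullet> x - L * ?q)) \<longlongrightarrow> (if i \<in> ?s then exp (lam i \<bullet> x) else 0)) at_top"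
        proof (cases "i \<in> ?s")
          case True
          then have "?q = 0" using supp_subset_iff[OF i] by (intro sum.neutral) auto
          then show ?thesis using True by simp
        next
          case ns: False
          then obtain \<alpha> where a: "\<alpha> \<in> \<Delta> - I" "representation \<Delta> (lam 1 - lam i) \<alpha> \<noteq> 0"
            using supp_subset_iff[OF i] i by blast
          \<comment> \<open>All summands are nonnegative and the one at \<open>\<alpha>\<close> is
            positive, so the exponent tends to minus infinity.\<close>
          have "?q > 0"
          proof (rule sum_pos2)
            show "0 < representation \<Delta> (lam 1 - lam i) \<alpha> * (\<alpha> \<bullet> (p + y))"
              using a True lam_dom i by (intro mult_pos_pos) (auto simp: order_less_le)
          qed (use a True lam_dom i finite_Delta in \<open>auto intro!: mult_nonneg_nonneg simp: less_imp_le\<close>)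
          then have "((\<lambda>L. exp (lam i \<bullet> x - L * ?q)) \<longlongrightarrow> 0) at_top"
            using filterlim_compose[OF exp_at_bot lin'[of "- ?q" "lam i \<bullet> x"]] by simp
          then show ?thesis unfolding if_not_P[OF ns] .
        qed
      qed
    qed
    then have "((\<lambda>L. f (exp (- L) *\<^sub>R phi_map k lam w (point L x y))) \<longlongrightarrow> f (psi_map \<Delta> k lam w ch x)) at_top"
      using f_cont by (intro continuous_on_tendsto_compose[OF f_cont]) auto
    then have "((\<lambda>L. indicator (dplus \<Delta> (lam 1) ch) x * f (exp (- L) *\<^sub>R phi_map k lam w (point L x y)) * exp (ch \<bullet> x))
        \<longlongrightarrow> indicator (dplus \<Delta> (lam 1) ch) x * f (psi_map \<Delta> k lam w ch x) * exp (ch \<bullet> x)) at_top"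
      by (intro tendsto_intros)
    then have "((\<lambda>L. integrand L x y)
        \<longlongrightarrow> indicator (dplus \<Delta> (lam 1) ch) x * f (psi_map \<Delta> k lam w ch x) * exp (ch \<bullet> x)) at_top"
      by (rule Lim_transform_eventually) (use ind in \<open>auto elim!: eventually_mono simp: integrand_def\<close>)
    then show ?thesis by (simp add: ly limit_x_def mult.assoc)
  qed
qed

text \<open>Where \<open>f\<close> does not vanish, the coefficient of \<open>w 1\<close> is
  bounded, hence so is \<open>\<lambda>_1\<close> at \<open>x\<close>, and \<open>ch_bound\<close>
  gives exponential decay in \<open>norm x\<close>. Half of that decay is traded for decay in
  \<open>norm y\<close> by \<open>transverse_bound\<close>.\<close>

lemma dominating:
  obtains C \<epsilon> \<delta> where "\<epsilon> > 0" "\<delta> > 0"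
    "\<And>L x y. L \<ge> 1 \<Longrightarrow> x \<in> D\<^sup>\<bottom> \<Longrightarrow> y \<in> D \<Longrightarrow> \<bar>integrand L x y\<bar> \<le> C * exp (- \<epsilon> * norm x) * exp (- \<delta> * norm y)"
    "\<And>x. x \<in> D\<^sup>\<bottom> \<Longrightarrow> \<bar>limit_x x\<bar> \<le> C * exp (- \<epsilon> * norm x)"
    "\<And>y. y \<in> D \<Longrightarrow> \<bar>limit_y y\<bar> \<le> C * exp (- \<delta> * norm y)"
proof -
  obtain F R where F: "F > 0" "R > 0" "\<And>z. \<bar>f z\<bar> \<le> F" "\<And>z. f z \<noteq> 0 \<Longrightarrow> norm z \<le> R"
    by (rule f_bounds) blast
  have k1: "1 \<in> {1..k}" using k by simp
  obtain K where K: "K > 0"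
    "\<And>s c. finite s \<Longrightarrow> s \<subseteq> {1..k} \<Longrightarrow> 1 \<in> s \<Longrightarrow> \<bar>c 1\<bar> \<le> K * norm (\<Sum>i\<in>s. c i *\<^sub>R w i)"
    by (rule bounded_coefficient[OF w_indep w_inj k1]) blast
  define c where "c = K * R"
  have c: "c \<ge> 0" using K F by (simp add: c_def)
  \<comment> \<open>Stated for an arbitrary index set containing 1: in both \<open>psi_map\<close>
    and the rescaled \<open>phi_map\<close> the coefficient of \<open>w 1\<close> is
    \<open>exp (lam 1 \<bullet> x)\<close>, as \<open>lam 1 - lam 1\<close> has no nonzero
    coefficients.\<close>
  have lam1_le: "lam 1 \<bullet> x \<le> c"
    if "finite s" "s \<subseteq> {1..k}" "1 \<in> s" "g 1 = exp (lam 1 \<bullet> x)" "f (\<Sum>i\<in>s. g i *\<^sub>R w i) \<noteq> 0" for x s g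
  proof -
    have "\<bar>g 1\<bar> \<le> K * norm (\<Sum>i\<in>s. g i *\<^sub>R w i)" using K(2)[of s g] that by blast
    also have "\<dots> \<le> c" unfolding c_def using K(1) F(4)[OF that(5)] by (intro mult_left_mono) auto
    finally have "exp (lam 1 \<bullet> x) \<le> c" using that(4) by simp
    then show ?thesis using exp_ge_add_one_self[of "lam 1 \<bullet> x"] by linarith
  qed
  obtain \<epsilon> C where C: "\<epsilon> > 0" "\<And>x. x \<in> D\<^sup>\<bottom> \<Longrightarrow> (\<And>\<alpha>. \<alpha> \<in> I \<Longrightarrow> \<alpha> \<bullet> x \<ge> 0) \<Longrightarrow> lam 1 \<bullet> x \<le> c
    \<Longrightarrow> ch \<bullet> x \<le> C - \<epsilon> * norm x"
    by (rule ch_bound[OF c]) blast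
  obtain B where B: "B > 0" "\<And>L x y. L \<ge> 1 \<Longrightarrow> y \<in> D \<Longrightarrow> L *\<^sub>R p + x + L *\<^sub>R y \<in> pos_chamber \<Delta>
    \<Longrightarrow> norm y \<le> B * (1 + norm x)"
    by (rule transverse_bound) blast
  \<comment> \<open>With this rate the bound on \<open>norm y\<close> costs exactly half of the
    decay in \<open>norm x\<close>, plus the constant \<open>\<epsilon> / 2\<close>.\<close>
  define \<delta> where "\<delta> = \<epsilon> / (2 * B)"
  have \<delta>: "\<delta> > 0" "\<delta> * B = \<epsilon> / 2" using C(1) B(1) by (auto simp: \<delta>_def)
  \<comment> \<open>The first entry serves \<open>integrand\<close> and \<open>limit_x\<close>, the
    second \<open>limit_y\<close>; the second also makes \<open>Q\<close> positive for the cases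
    where the function is 0.\<close>
  define Q where "Q = max (F * exp (C + \<epsilon> / 2)) (exp (\<epsilon> / 2))"
  have Q: "F * exp (C + \<epsilon> / 2) \<le> Q" "exp (\<epsilon> / 2) \<le> Q" by (auto simp: Q_def)
  have fx: "\<bar>f z * exp (ch \<bullet> x)\<bar> \<le> F * exp (C - \<epsilon> * norm x)"
    if "ch \<bullet> x \<le> C - \<epsilon> * norm x" for x z
    using that F(1,3) by (simp add: abs_mult mult_mono)
  show ?thesis
  proof (rule that[of "\<epsilon> / 2" \<delta> Q])
    show "\<epsilon> / 2 > 0" "\<delta> > 0" using C(1) \<delta> by auto
    fix L :: real and x y assume L: "L \<ge> 1" and x: "x \<in> D\<^sup>\<bottom>" and y: "y \<in> D"
    show "\<bar>integrand L x y\<bar> \<le> Q * exp (- (\<epsilon> / 2) * norm x) * exp (- \<delta> * norm y)"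
    proof (cases "integrand L x y = 0")
      case True
      then show ?thesis using Q(2) by (simp add: order_trans[OF _ Q(2)])
    next
      case False
      then have pos: "point L x y \<in> pos_chamber \<Delta>"
        and fnz: "f (exp (- L) *\<^sub>R phi_map k lam w (point L x y)) \<noteq> 0"
        by (auto simp: integrand_def indicator_def split: if_splits)
      have ix: "\<alpha> \<bullet> x \<ge> 0" if "\<alpha> \<in> I" for \<alpha>
      proof -
        have "\<alpha> \<bullet> point L x y \<ge> 0" using pos that I_subset by (auto simp: pos_chamber_def)
        then show ?thesis using I_p[OF that] I_D[OF that y] by (simp add: inner_point inner_add_right)
      qed
      have "lam 1 \<bullet> x \<le> c"
        by (rule lam1_le[OF _ _ _ _ fnz[unfolded scaled_phi_map[OF y]]])
          (use k1 in \<open>auto simp: representation_zero\<close>)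
      then have chx: "ch \<bullet> x \<le> C - \<epsilon> * norm x" using C(2)[OF x] ix by blast
      have "norm y \<le> B * (1 + norm x)" using B(2)[OF L y] pos by (simp add: point_def)
      then have "\<delta> * norm y \<le> \<delta> * (B * (1 + norm x))" using \<delta>(1) by (intro mult_left_mono) auto
      also have "\<dots> = \<epsilon> / 2 * (1 + norm x)" using \<delta>(2) by (simp add: mult.assoc[symmetric])
      finally have dy: "\<delta> * norm y \<le> \<epsilon> / 2 + \<epsilon> / 2 * norm x" by (simp add: algebra_simps)
      have "\<bar>integrand L x y\<bar> \<le> F * exp (C - \<epsilon> * norm x)"
        using fx[OF chx] pos by (simp add: integrand_def)
      also have "\<dots> \<le> F * exp ((C + \<epsilon> / 2) + - (\<epsilon> / 2) * norm x + - \<delta> * norm y)"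
        using dy F(1) by (intro mult_left_mono) (simp_all add: algebra_simps)
      also have "\<dots> = F * exp (C + \<epsilon> / 2) * exp (- (\<epsilon> / 2) * norm x) * exp (- \<delta> * norm y)"
        by (simp only: exp_add mult.assoc)
      also have "\<dots> \<le> Q * exp (- (\<epsilon> / 2) * norm x) * exp (- \<delta> * norm y)"
        using Q(1) by (intro mult_right_mono) auto
      finally show ?thesis .
    qed
  next
    fix x assume x: "x \<in> D\<^sup>\<bottom>"
    show "\<bar>limit_x x\<bar> \<le> Q * exp (- (\<epsilon> / 2) * norm x)"
    proof (cases "limit_x x = 0")
      case True
      then show ?thesis using Q(2) by (simp add: order_trans[OF _ Q(2)])
    next
      case False
      then have dp: "x \<in> dplus \<Delta> (lam 1) ch" and fnz: "f (psi_map \<Delta> k lam w ch x) \<noteq> 0"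
        by (auto simp: limit_x_def indicator_def split: if_splits)
      have "lam 1 \<bullet> x \<le> c"
        by (rule lam1_le[OF _ _ _ _ fnz[unfolded psi_map_def]])
          (use k1 in \<open>auto simp: supp_lam_def representation_zero\<close>)
      then have chx: "ch \<bullet> x \<le> C - \<epsilon> * norm x" using C(2)[OF x] dp by (auto simp: dplus_def)
      have "\<bar>limit_x x\<bar> \<le> F * exp (C - \<epsilon> * norm x)"
        using fx[OF chx] dp by (simp add: limit_x_def)
      also have "\<dots> \<le> F * exp ((C + \<epsilon> / 2) + - (\<epsilon> / 2) * norm x)"
        using C(1) F(1) by (intro mult_left_mono) (simp_all add: algebra_simps)
      also have "\<dots> = F * exp (C + \<epsilon> / 2) * exp (- (\<epsilon> / 2) * norm x)"
        by (simp only: exp_add mult.assoc)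
      also have "\<dots> \<le> Q * exp (- (\<epsilon> / 2) * norm x)"
        using Q(1) by (intro mult_right_mono) auto
      finally show ?thesis .
    qed
  next
    fix y assume y: "y \<in> D"
    show "\<bar>limit_y y\<bar> \<le> Q * exp (- \<delta> * norm y)"
    proof (cases "p + y \<in> pos_chamber \<Delta>")
      case True
      \<comment> \<open>This is the bound at \<open>L = 1\<close> and \<open>x = 0\<close>.\<close>
      then have "norm y \<le> B" using B(2)[of 1 y 0] y by simp
      then have "\<delta> * norm y \<le> \<epsilon> / 2" unfolding \<delta>(2)[symmetric] using \<delta>(1) by (intro mult_left_mono) auto
      then have "1 \<le> exp (\<epsilon> / 2) * exp (- \<delta> * norm y)" by (simp add: exp_add[symmetric])
      also have "\<dots> \<le> Q * exp (- \<delta> * norm y)" using Q(2) by (intro mult_right_mono) auto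
      finally show ?thesis using True by (simp add: limit_y_def)
    next
      case False
      then show ?thesis using Q(2) by (simp add: limit_y_def order_trans[OF _ Q(2)])
    qed
  qed
qed

text \<open>These are the hypotheses of \<open>integrand_tendsto\<close>. The exceptional
  \<open>y\<close> lie on finitely many hyperplanes, each null by
  \<open>maximal_nonzero\<close>.\<close>

lemma AE_generic:
  "AE (x, y) in M1 \<Otimes>\<^sub>M M0. x \<in> D\<^sup>\<bottom> \<and> y \<in> D \<and> (\<forall>\<alpha>\<in>\<Delta> - I. \<alpha> \<bullet> (p + y) \<noteq> 0)"
proof -
  have [measurable]: "D \<in> sets borel" "D\<^sup>\<bottom> \<in> sets borel"
    using closed_subspace[OF subspace_D] closed_subspace[OF subspace_orthogonal_comp, of D] by auto
  have "AE z in M1 \<Otimes>\<^sub>M M0. fst z \<in> D\<^sup>\<bottom>"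
  proof (rule P.AE_pair_measure)
    show "{z \<in> space (M1 \<Otimes>\<^sub>M M0). fst z \<in> D\<^sup>\<bottom>} \<in> sets (M1 \<Otimes>\<^sub>M M0)" by measurable
  qed (use AE_subspace_measure[OF subspace_orthogonal_comp, of D] in \<open>auto elim!: eventually_mono\<close>)
  moreover have "AE z in M1 \<Otimes>\<^sub>M M0. snd z \<in> D"
  proof (rule P.AE_pair_measure)
    show "{z \<in> space (M1 \<Otimes>\<^sub>M M0). snd z \<in> D} \<in> sets (M1 \<Otimes>\<^sub>M M0)" by measurable
  qed (use AE_subspace_measure[OF subspace_D] in \<open>auto elim!: eventually_mono\<close>)
  moreover have "AE z in M1 \<Otimes>\<^sub>M M0. \<forall>\<alpha>\<in>\<Delta> - I. \<alpha> \<bullet> (p + snd z) \<noteq> 0"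
  proof (rule AE_finite_allI)
    fix \<alpha> assume a: "\<alpha> \<in> \<Delta> - I"
    have "AE y in M0. \<alpha> \<bullet> y \<noteq> - (\<alpha> \<bullet> p)"
      by (rule AE_subspace_measure_hyperplane[OF subspace_D maximal_nonzero[OF a]])
    then have "AE y in M0. \<alpha> \<bullet> (p + y) \<noteq> 0"
      by eventually_elim (simp add: inner_add_right eq_neg_iff_add_eq_0 add.commute)
    moreover have "{z \<in> space (M1 \<Otimes>\<^sub>M M0). \<alpha> \<bullet> (p + snd z) \<noteq> 0} \<in> sets (M1 \<Otimes>\<^sub>M M0)"
      by measurable
    ultimately show "AE z in M1 \<Otimes>\<^sub>M M0. \<alpha> \<bullet> (p + snd z) \<noteq> 0"
      by (intro P.AE_pair_measure) auto
  qed (use finite_Delta in simp)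
  ultimately show ?thesis by eventually_elim auto
qed

section \<open>Dominated convergence and the return to the chamber\<close>

lemma integrable_limit_x: "integrable M1 limit_x"
  and integrable_limit_y: "integrable M0 limit_y"
  and integrable_integrand: "L \<ge> 1 \<Longrightarrow> integrable (M1 \<Otimes>\<^sub>M M0) (\<lambda>(x, y). integrand L x y)"
  and integral_integrand_tendsto:
    "((\<lambda>L. \<integral>(x, y). integrand L x y \<partial>(M1 \<Otimes>\<^sub>M M0)) \<longlongrightarrow> integral\<^sup>L M1 limit_x * integral\<^sup>L M0 limit_y) at_top"
proof -
  obtain C \<epsilon> \<delta> where pos: "\<epsilon> > 0" "\<delta> > 0"
    and b: "\<And>L x y. L \<ge> 1 \<Longrightarrow> x \<in> D\<^sup>\<bottom> \<Longrightarrow> y \<in> D \<Longrightarrow> \<bar>integrand L x y\<bar> \<le> C * exp (- \<epsilon> * norm x) * exp (- \<delta> * norm y)"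
    and bx: "\<And>x. x \<in> D\<^sup>\<bottom> \<Longrightarrow> \<bar>limit_x x\<bar> \<le> C * exp (- \<epsilon> * norm x)"
    and byy: "\<And>y. y \<in> D \<Longrightarrow> \<bar>limit_y y\<bar> \<le> C * exp (- \<delta> * norm y)"
    by (rule dominating) blast
  have ix: "integrable M1 (\<lambda>x. C * exp (- \<epsilon> * norm x))"
    using integrable_exp_norm_subspace_measure[OF subspace_orthogonal_comp pos(1), of D] by simp
  have iy: "integrable M0 (\<lambda>y. exp (- \<delta> * norm y))"
    using integrable_exp_norm_subspace_measure[OF subspace_D pos(2)] by simp
  show X: "integrable M1 limit_x"
    by (rule Bochner_Integration.integrable_bound[OF ix], simp,
        use AE_subspace_measure[OF subspace_orthogonal_comp, of D] in eventually_elim)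
      (use bx in \<open>force intro: order_trans[OF _ abs_ge_self]\<close>)
  show Y: "integrable M0 limit_y"
    by (rule Bochner_Integration.integrable_bound[OF integrable_mult_right[OF iy, of C]], simp,
        use AE_subspace_measure[OF subspace_D] in eventually_elim)
      (use byy in \<open>force intro: order_trans[OF _ abs_ge_self]\<close>)
  have W: "integrable (M1 \<Otimes>\<^sub>M M0) (\<lambda>(x, y). C * exp (- \<epsilon> * norm x) * exp (- \<delta> * norm y))"
    by (rule P.integrable_pair_mult[OF ix iy])
  have bound: "AE z in M1 \<Otimes>\<^sub>M M0. norm (case z of (x, y) \<Rightarrow> integrand L x y)
      \<le> (case z of (x, y) \<Rightarrow> C * exp (- \<epsilon> * norm x) * exp (- \<delta> * norm y))" if "L \<ge> 1" for L
    using AE_generic by eventually_elim (use b[OF that] in auto)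
  show "integrable (M1 \<Otimes>\<^sub>M M0) (\<lambda>(x, y). integrand L x y)" if "L \<ge> 1"
    by (rule Bochner_Integration.integrable_bound[OF W], simp, use bound[OF that] in eventually_elim)
      (auto intro: order_trans[OF _ abs_ge_self])
  have "((\<lambda>L. \<integral>(x, y). integrand L x y \<partial>(M1 \<Otimes>\<^sub>M M0)) \<longlongrightarrow> (\<integral>(x, y). limit_x x * limit_y y \<partial>(M1 \<Otimes>\<^sub>M M0))) at_top"
  proof (rule integral_dominated_convergence_at_top[OF _ _ W])
    show "\<forall>\<^sub>F L in at_top. AE z in M1 \<Otimes>\<^sub>M M0. norm (case z of (x, y) \<Rightarrow> integrand L x y)
      \<le> (case z of (x, y) \<Rightarrow> C * exp (- \<epsilon> * norm x) * exp (- \<delta> * norm y))"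
      using eventually_ge_at_top[of 1] by eventually_elim (rule bound)
    show "AE z in M1 \<Otimes>\<^sub>M M0. ((\<lambda>L. case z of (x, y) \<Rightarrow> integrand L x y)
        \<longlongrightarrow> (case z of (x, y) \<Rightarrow> limit_x x * limit_y y)) at_top"
      using AE_generic by eventually_elim (auto intro!: integrand_tendsto)
  qed measurable
  then show "((\<lambda>L. \<integral>(x, y). integrand L x y \<partial>(M1 \<Otimes>\<^sub>M M0)) \<longlongrightarrow> integral\<^sup>L M1 limit_x * integral\<^sup>L M0 limit_y) at_top"
    by (simp only: P.integral_pair_mult[OF X Y])
qed

lemma L_chi_eq: "L_chi \<Delta> k lam w ch f = integral\<^sup>L M1 limit_x"
  by (simp add: L_chi_def set_lebesgue_integral_def limit_x_def[abs_def])

lemma kappa_chi_eq: "kappa_chi \<Delta> (lam 1) ch = integral\<^sup>L M0 limit_y"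
  by (simp add: kappa_eq limit_y_def[abs_def])

text \<open>The substitution \<open>a = L *\<^sub>R p + x + L *\<^sub>R y\<close> with
  \<open>L = ln T\<close>; the bound on \<open>T\<close> gives \<open>L \<ge> 1\<close>, as the
  dominating function requires. The power of \<open>T\<close> comes from the weight and that of
  \<open>ln T\<close> from the Jacobian.\<close>

lemma
  assumes T: "T \<ge> exp 1"
  shows chamber_integrable: "set_integrable lborel (pos_chamber \<Delta>)
      (\<lambda>a. f ((1 / T) *\<^sub>R phi_map k lam w a) * exp (ch \<bullet> a))"
    and chamber_integral: "set_lebesgue_integral lborel (pos_chamber \<Delta>)
      (\<lambda>a. f ((1 / T) *\<^sub>R phi_map k lam w a) * exp (ch \<bullet> a))
     = T powr A * ln T powr (real (b_chi \<Delta> (lam 1) ch) - 1)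
       * (\<integral>(x, y). integrand (ln T) x y \<partial>(M1 \<Otimes>\<^sub>M M0))"
proof -
  define L where "L = ln T"
  have T0: "T > 0" using T exp_gt_zero[of 1] by linarith
  have L1: "L \<ge> 1" unfolding L_def using T T0 by (simp add: ln_ge_iff)
  have TL: "1 / T = exp (- L)" "T powr A = exp (A * L)"
    using T0 by (simp_all add: L_def exp_minus powr_def field_simps)
  define G where "G a = indicator (pos_chamber \<Delta>) a *\<^sub>R (f ((1 / T) *\<^sub>R phi_map k lam w a) * exp (ch \<bullet> a))" for a
  have [measurable]: "G \<in> borel_measurable borel" unfolding G_def by measurable
  have AE: "AE z in M1 \<Otimes>\<^sub>M M0. (case z of (x, y) \<Rightarrow> G (L *\<^sub>R p + x + L *\<^sub>R y))
      = T powr A * (case z of (x, y) \<Rightarrow> integrand L x y)"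
    using AE_generic
  proof eventually_elim
    case (elim z)
    obtain x y where z: "z = (x, y)" by force
    then have y: "y \<in> D" using elim by simp
    \<comment> \<open>\<open>\<chi>\<close> is \<open>A\<close> at \<open>p\<close> and vanishes on
      \<open>D\<close>, so the weight splits off \<open>exp (A * L)\<close>, which is
      \<open>T powr A\<close>.\<close>
    have "ch \<bullet> point L x y = ch \<bullet> x + A * L"
      using ch_p ch_D[OF y] by (simp add: inner_point inner_add_right)
    then show ?case
      unfolding z G_def TL point_def[symmetric] by (simp add: integrand_def exp_add)
  qed
  have int: "integrable (M1 \<Otimes>\<^sub>M M0) (\<lambda>z. T powr A * (case z of (x, y) \<Rightarrow> integrand L x y))"
    by (intro integrable_mult_right integrable_integrand L1)
  have int': "integrable (M1 \<Otimes>\<^sub>M M0) (\<lambda>(x, y). G (L *\<^sub>R p + x + L *\<^sub>R y))"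
    by (rule integrable_cong_AE[THEN iffD2, OF _ _ AE int]) measurable
  show "set_integrable lborel (pos_chamber \<Delta>) (\<lambda>a. f ((1 / T) *\<^sub>R phi_map k lam w a) * exp (ch \<bullet> a))"
    unfolding set_integrable_def G_def[symmetric]
    using int' L1 by (subst integrable_lborel_subspace_split[OF subspace_D, of L _ "L *\<^sub>R p"]) auto
  have "integral\<^sup>L lborel G = L ^ dim D * (\<integral>(x, y). G (L *\<^sub>R p + x + L *\<^sub>R y) \<partial>(M1 \<Otimes>\<^sub>M M0))"
    using L1 by (intro integral_lborel_subspace_split[OF subspace_D]) auto
  also have "(\<integral>(x, y). G (L *\<^sub>R p + x + L *\<^sub>R y) \<partial>(M1 \<Otimes>\<^sub>M M0))
      = (\<integral>z. T powr A * (case z of (x, y) \<Rightarrow> integrand L x y) \<partial>(M1 \<Otimes>\<^sub>M M0))"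
    by (rule integral_cong_AE[OF _ _ AE]) measurable
  also have "\<dots> = T powr A * (\<integral>(x, y). integrand L x y \<partial>(M1 \<Otimes>\<^sub>M M0))"
    by (rule integral_mult_right_zero)
  also have "L ^ dim D = L powr (real (b_chi \<Delta> (lam 1) ch) - 1)"
    unfolding dim_D[symmetric] using L1 by (simp add: powr_realpow)
  finally show "set_lebesgue_integral lborel (pos_chamber \<Delta>)
      (\<lambda>a. f ((1 / T) *\<^sub>R phi_map k lam w a) * exp (ch \<bullet> a))
     = T powr A * ln T powr (real (b_chi \<Delta> (lam 1) ch) - 1)
       * (\<integral>(x, y). integrand (ln T) x y \<partial>(M1 \<Otimes>\<^sub>M M0))"
    unfolding set_lebesgue_integral_def G_def[symmetric] L_def by (simp add: mult_ac)
qed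

lemma chamber_asymptotics:
  "((\<lambda>T. set_lebesgue_integral lborel (pos_chamber \<Delta>)
              (\<lambda>a. f ((1 / T) *\<^sub>R phi_map k lam w a) * exp (ch \<bullet> a))
            / (T powr A * ln T powr (real (b_chi \<Delta> (lam 1) ch) - 1)))
       \<longlongrightarrow> kappa_chi \<Delta> (lam 1) ch * L_chi \<Delta> k lam w ch f) at_top"
proof -
  have "((\<lambda>T. \<integral>(x, y). integrand (ln T) x y \<partial>(M1 \<Otimes>\<^sub>M M0)) \<longlongrightarrow> kappa_chi \<Delta> (lam 1) ch * L_chi \<Delta> k lam w ch f) at_top"
    unfolding kappa_chi_eq L_chi_eq mult.commute[of "integral\<^sup>L M0 limit_y"]
    by (rule filterlim_compose[OF integral_integrand_tendsto ln_at_top])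
  moreover have "\<forall>\<^sub>F T in at_top. (\<integral>(x, y). integrand (ln T) x y \<partial>(M1 \<Otimes>\<^sub>M M0))
     = set_lebesgue_integral lborel (pos_chamber \<Delta>)
              (\<lambda>a. f ((1 / T) *\<^sub>R phi_map k lam w a) * exp (ch \<bullet> a))
            / (T powr A * ln T powr (real (b_chi \<Delta> (lam 1) ch) - 1))"
    using eventually_ge_at_top[of "exp 1"]
  proof eventually_elim
    case (elim T)
    then have T0: "T > 0" using exp_gt_zero[of 1] by linarith
    have "ln T \<ge> 1" using elim T0 by (simp add: ln_ge_iff)
    \<comment> \<open>Ensures that \<open>ln T\<close> is nonzero, so that the normalising factor
      can be cancelled.\<close>
    then have "T \<noteq> 1" by auto
    then show ?case using T0 unfolding chamber_integral[OF elim] by simp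
  qed
  ultimately show ?thesis by (rule Lim_transform_eventually)
qed

end

text \<open>The Bochner integral of a non-integrable function is 0 by default; the two integrability
  claims ensure that the limit concerns genuine integrals and that \<open>L_chi\<close> is
  finite.\<close>

theorem theorem6p1:
  fixes \<Delta> :: "'a::euclidean_space set"
    and k :: nat and lam :: "nat \<Rightarrow> 'a" and w :: "nat \<Rightarrow> 'w::euclidean_space"
    and ch :: 'a and f :: "'w \<Rightarrow> real"
  assumes k: "k \<ge> 1"
    and w_indep: "independent (w ` {1..k})" and w_inj: "inj_on w {1..k}"
    and Delta_basis: "independent \<Delta>" "span \<Delta> = UNIV"
    and lam1_pos: "\<forall>\<alpha>\<in>\<Delta>. representation \<Delta> (lam 1) \<alpha> > 0"
    and lam_dom: "\<forall>i\<in>{1..k}. \<forall>\<alpha>\<in>\<Delta>. representation \<Delta> (lam 1 - lam i) \<alpha> \<ge> 0"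
    and f_cont: "continuous_on UNIV f" and f_supp: "compact (closure {x. f x \<noteq> 0})"
    and a_pos: "a_chi \<Delta> (lam 1) ch > 0"
  shows "set_integrable (subspace_measure (orthogonal_comp (d0_chi \<Delta> (lam 1) ch)))
           (dplus \<Delta> (lam 1) ch) (\<lambda>x. f (psi_map \<Delta> k lam w ch x) * exp (ch \<bullet> x))
    \<and> (\<forall>\<^sub>F T in at_top. set_integrable lborel (pos_chamber \<Delta>)
           (\<lambda>a. f ((1 / T) *\<^sub>R phi_map k lam w a) * exp (ch \<bullet> a)))
    \<and> ((\<lambda>T. set_lebesgue_integral lborel (pos_chamber \<Delta>)
              (\<lambda>a. f ((1 / T) *\<^sub>R phi_map k lam w a) * exp (ch \<bullet> a))
            / (T powr a_chi \<Delta> (lam 1) ch * ln T powr (real (b_chi \<Delta> (lam 1) ch) - 1)))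
       \<longlongrightarrow> kappa_chi \<Delta> (lam 1) ch * L_chi \<Delta> k lam w ch f) at_top"
proof -
  interpret exponential_sum \<Delta> k lam w ch f
    by unfold_locales (fact k w_indep w_inj Delta_basis lam1_pos lam_dom f_cont f_supp a_pos)+
  have "set_integrable (subspace_measure (D\<^sup>\<bottom>)) (dplus \<Delta> (lam 1) ch)
      (\<lambda>x. f (psi_map \<Delta> k lam w ch x) * exp (ch \<bullet> x))"
    using integrable_limit_x by (simp add: set_integrable_def limit_x_def[abs_def])
  moreover have "\<forall>\<^sub>F T in at_top. set_integrable lborel (pos_chamber \<Delta>)
      (\<lambda>a. f ((1 / T) *\<^sub>R phi_map k lam w a) * exp (ch \<bullet> a))"
    using eventually_ge_at_top[of "exp 1"] by eventually_elim (rule chamber_integrable)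
  ultimately show ?thesis using chamber_asymptotics by blast
qed

end
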